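(* Let $f(x)=x^TAx+2a^Tx+a_0$ and $g(x)=x^TBx+2b^Tx+b_0$ be functions on $\mathbb{R}^n$, where $A,B$ are real symmetric $n\times n$ matrices, $a,b\in\mathbb{R}^n$, $a_0,b_0\in\mathbb{R}$, and $A\neq 0$. The joint numerical range $\mathbf{R}(f,g)=\{(f(x),g(x)) : x\in\mathbb{R}^n\}\subset\mathbb{R}^2$ is non-convex if and only if the matrix $\bar A=A$ or $\bar A=-A$ satisfies the following four conditions: (B0) $B=\lambda A$ for some $\lambda\in\mathbb{R}$; (B1) $\bar A$ has exactly one negative eigenvalue, and $a\in\mathcal{R}(A)$; (B2) $-\lambda a+b\in\mathcal{R}(A)$ and $-\lambda a+b\neq 0$; (B3) $V^T\bar A V\succeq 0$, where $\lambda$ in (B2) and in the definition of $V$ is the one from (B0), and $V\in\mathbb{R}^{n\times(n-1)}$ is a matrix basis of $\mathcal{N}((-\lambda a+b)^T)$.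
   Context: $\mathcal{R}(P)$ and $\mathcal{N}(P)$ denote the range (column) space and the null space of a matrix $P$. $V$ being a matrix basis of a subspace means that the columns of $V$ form a basis of that subspace; thus for a nonzero vector $c\in\mathbb{R}^n$, a matrix basis of $\mathcal{N}(c^T)=\{x\in\mathbb{R}^n : c^Tx=0\}$ is an $n\times(n-1)$ matrix. $M\succeq0$ means that the symmetric matrix $M$ is positive semidefinite. Eigenvalues are counted with multiplicity. *)

theory Defs
  imports
    "HOL-Analysis.Analysis"
    "Jordan_Normal_Form.Char_Poly"
    "Jordan_Normal_Form.Matrix_Kernel"
begin

text \<open>
  Matrices and vectors are those of Jordan-Normal-Form, whose dimensions are natural numbers:
  for \<open>n = 1\<close> a matrix basis of a hyperplane is a \<open>1 \<times> 0\<close> matrix, and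
  types cannot serve as an index set with \<open>n - 1 = 0\<close> elements.
\<close>

unbundle no inner_syntax
unbundle no vec_syntax

definition quadratic_fun :: "real mat \<Rightarrow> real vec \<Rightarrow> real \<Rightarrow> real vec \<Rightarrow> real" where
  "quadratic_fun A a a0 x = x \<bullet> (A *\<^sub>v x) + 2 * (a \<bullet> x) + a0"

definition joint_range :: "nat \<Rightarrow> (real vec \<Rightarrow> real) \<Rightarrow> (real vec \<Rightarrow> real) \<Rightarrow> (real \<times> real) set" where
  "joint_range n f g = {(f x, g x) | x. x \<in> carrier_vec n}"

definition pos_semidef :: "real mat \<Rightarrow> bool" where
  "pos_semidef M \<longleftrightarrow>
     square_mat M \<and> M\<^sup>T = M \<and> (\<forall>x \<in> carrier_vec (dim_row M). 0 \<le> x \<bullet> (M *\<^sub>v x))"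

text \<open>
  The number of negative eigenvalues counted with (algebraic) multiplicity: \<open>proots\<close> is the
  multiset of real roots. For symmetric matrices all eigenvalues are real, and algebraic and
  geometric multiplicities agree.
\<close>

definition neg_eigenvalue_count :: "real mat \<Rightarrow> nat" where
  "neg_eigenvalue_count M = size {# e \<in># proots (char_poly M). e < 0 #}"

definition range_space :: "real mat \<Rightarrow> real vec set" where
  "range_space P = vec_space.col_space (dim_row P) P"

text \<open>
  Distinctness is needed because the independence predicate speaks about the \<^emph>\<open>set\<close> of columns.
\<close>

definition matrix_basis :: "real mat \<Rightarrow> real vec set \<Rightarrow> bool" where
  "matrix_basis V W \<longleftrightarrow>
     distinct (cols V) \<and>
     \<not> LinearCombinations.module.lin_dep class_ring
         (module_vec TYPE(real) (dim_row V)) (set (cols V)) \<and>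
     range_space V = W"

end

theory Submission
  imports Defs "Jordan_Normal_Form.Schur_Decomposition"
begin

text \<open>
  If the range is not convex, some segment between \<open>(f x, g x)\<close> and \<open>(f y, g y)\<close> contains a point
  outside it. Let \<open>h\<close> and \<open>k\<close> be the components of \<open>(f, g)\<close>, recentred at that point,
  orthogonal to and along the segment: then \<open>h x = h y = 0\<close>, \<open>k x < 0 < k y\<close>, and \<open>h\<close>, \<open>k\<close> have no
  common zero. On every plane through \<open>x\<close> and \<open>y\<close> the two points therefore lie on different
  branches of a hyperbola \<open>h = 0\<close>, and \<open>k\<close> has opposite signs on the branches; comparing growth
  along the branches shows that \<open>k\<close> is a multiple of \<open>h\<close> plus an affine function \<open>2 u \<bullet> x + const\<close>,
  whose slope is so steep along the axis of the hyperbola that the form of \<open>h\<close> (suitably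
  signed) is nonnegative on the hyperplane orthogonal to \<open>u\<close>.

  Conversely, after centring, let \<open>e\<close> be an eigenvector for the negative eigenvalue. The midpoint
  of the images of \<open>e\<close> and \<open>- e\<close> can only be the image of a point of the hyperplane, where
  the form is nonnegative.
\<close>

section \<open>Separated hyperbolas in the plane\<close>

lemma le_at_0_of_punctured:
  fixes f g :: "real \<Rightarrow> real"
  assumes "isCont f 0" "isCont g 0" and le: "\<And>r. r \<noteq> 0 \<Longrightarrow> f r \<le> g r"
  shows "f 0 \<le> g 0"
proof (rule tendsto_le)
  show "(g \<longlongrightarrow> g 0) (at 0)" "(f \<longlongrightarrow> f 0) (at 0)"
    using assms by (auto simp: isCont_def)
  show "\<forall>\<^sub>F r in at 0. f r \<le> g r"
    using le by (auto simp: eventually_at intro!: exI[of _ 1])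
qed simp

text \<open>This compares growth at infinity. With \<open>s = 1 / r\<close>, multiplying by
  \<open>r ^ 4\<close> turns \<open>a\<close> into a value at \<open>r = 0\<close>, where the right
  side vanishes; once \<open>a = 0\<close>, multiplying by \<open>r\<^sup>2\<close> does the same
  for \<open>b\<close> and \<open>D\<close>.\<close>

lemma square_quadratic_le_quadratic:
  fixes a b c D E F :: real
  assumes le: "\<And>s. (a * s\<^sup>2 + b * s + c)\<^sup>2 \<le> D * s\<^sup>2 + E * s + F"
  shows "a = 0" "b\<^sup>2 \<le> D"
proof -
  have "(a + b * r + c * r\<^sup>2)\<^sup>2 \<le> D * r\<^sup>2 + E * r ^ 3 + F * r ^ 4" if "r \<noteq> 0" for r
  proof -
    have "r ^ 4 * (a * (1 / r)\<^sup>2 + b * (1 / r) + c)\<^sup>2 \<le> r ^ 4 * (D * (1 / r)\<^sup>2 + E * (1 / r) + F)"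
      using le[of "1 / r"] by (intro mult_left_mono) auto
    moreover have "r ^ 4 * (a * (1 / r)\<^sup>2 + b * (1 / r) + c)\<^sup>2 = (a + b * r + c * r\<^sup>2)\<^sup>2"
      using that by (simp add: field_simps eval_nat_numeral)
    moreover have "r ^ 4 * (D * (1 / r)\<^sup>2 + E * (1 / r) + F) = D * r\<^sup>2 + E * r ^ 3 + F * r ^ 4"
      using that by (simp add: field_simps eval_nat_numeral)
    ultimately show ?thesis by simp
  qed
  from le_at_0_of_punctured[where f = "\<lambda>r. (a + b * r + c * r\<^sup>2)\<^sup>2", OF _ _ this]
  show a: "a = 0" by simp
  have "(b + c * r)\<^sup>2 \<le> D + E * r + F * r\<^sup>2" if "r \<noteq> 0" for r
  proof -
    have "r\<^sup>2 * (b * (1 / r) + c)\<^sup>2 \<le> r\<^sup>2 * (D * (1 / r)\<^sup>2 + E * (1 / r) + F)"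
      using le[of "1 / r"] a by (intro mult_left_mono) auto
    moreover have "r\<^sup>2 * (b * (1 / r) + c)\<^sup>2 = (b + c * r)\<^sup>2"
      using that by (simp add: field_simps eval_nat_numeral)
    moreover have "r\<^sup>2 * (D * (1 / r)\<^sup>2 + E * (1 / r) + F) = D + E * r + F * r\<^sup>2"
      using that by (simp add: field_simps eval_nat_numeral)
    ultimately show ?thesis by simp
  qed
  from le_at_0_of_punctured[where f = "\<lambda>r. (b + c * r)\<^sup>2", OF _ _ this] show "b\<^sup>2 \<le> D" by simp
qed

text \<open>Take the minimum of the compact zero set; by the intermediate value theorem, a negative
  value before it would produce an earlier zero. The lemma isolates the stretch on which
  \<open>sqrt (q s)\<close> still parametrizes a branch of a hyperbola.\<close>

lemma first_zero:
  fixes q :: "real \<Rightarrow> real"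
  assumes cont: "continuous_on {0..1} q" and q: "q 0 > 0" "q 1 \<le> 0"
  obtains r where "0 < r" "r \<le> 1" "q r = 0" "\<And>s. 0 \<le> s \<Longrightarrow> s \<le> r \<Longrightarrow> 0 \<le> q s"
proof -
  let ?Z = "{s \<in> {0..1}. q s = 0}"
  have "closed ?Z"
    by (intro continuous_closed_preimage_constant cont) simp
  then have "compact ?Z"
    using compact_Int_closed[OF compact_Icc, of ?Z 0 1] by (simp only: Int_absorb1 Collect_subset)
  moreover have "\<exists>s\<ge>0. s \<le> 1 \<and> q s = 0"
    using IVT2'[of q 1 0 0] q cont by auto
  then have "?Z \<noteq> {}" by auto
  ultimately obtain r where r: "r \<in> ?Z" and min: "\<And>s. s \<in> ?Z \<Longrightarrow> r \<le> s"
    using compact_attains_inf[of ?Z] by blast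
  have "0 \<le> q s" if "0 \<le> s" "s \<le> r" for s
  proof (rule ccontr)
    assume "\<not> 0 \<le> q s"
    then have "q s < 0" by simp
    moreover have "continuous_on {0..s} q"
      using that r by (intro continuous_on_subset[OF cont]) auto
    ultimately obtain t where t: "0 \<le> t" "t \<le> s" "q t = 0"
      using IVT2'[of q s 0 0] q \<open>0 \<le> s\<close> by auto
    then have "t = r" using min[of t] \<open>s \<le> r\<close> r by auto
    then show False using t \<open>s \<le> r\<close> \<open>q s < 0\<close> r by auto
  qed
  moreover have "r \<noteq> 0" using r q by auto
  ultimately show ?thesis using r by (intro that[of r]) (auto simp: less_le)
qed

lemma pos_everywhere_of_no_zero:
  fixes q :: "real \<Rightarrow> real"
  assumes cont: "continuous_on UNIV q" and nz: "\<And>s. q s \<noteq> 0" and "q s0 > 0"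
  shows "q s > 0"
proof (rule ccontr)
  assume "\<not> q s > 0"
  then have s: "q s < 0" using nz[of s] by linarith
  have c: "continuous_on I q" for I using cont continuous_on_subset by blast
  show False
  proof (cases "s0 \<le> s")
    case True then show ?thesis using IVT2'[of q s 0 s0] s \<open>q s0 > 0\<close> nz c by fastforce
  next
    case False then show ?thesis using IVT'[of q s 0 s0] s \<open>q s0 > 0\<close> nz c by fastforce
  qed
qed

lemma affine_pos_everywhere:
  fixes l j :: real
  assumes "\<And>s. 0 < l * s + j"
  shows "l = 0" "0 < j"
proof -
  show "0 < j" using assms[of 0] by simp
  show "l = 0"
  proof (rule ccontr)
    assume "l \<noteq> 0"
    then show False using assms[of "- j / l"] by simp
  qed
qed

text \<open>The two points are \<open>(- 1, 0)\<close> and \<open>(1, 0)\<close>, and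
  \<open>h = 0\<close> consists of the branches \<open>t = sqrt (q s)\<close> and
  \<open>t = - sqrt (q s)\<close>. On each of them \<open>k\<close> keeps its sign, which bounds the
  part of \<open>k\<close> even in \<open>t\<close> by the odd part; comparing growth then leaves
  only an affine function in \<open>k + \<kappa> * h\<close>, namely
  \<open>2 * j * t + 2 * (p + \<kappa> * P) * s\<close> plus a constant, and bounds its slope in
  \<open>s\<close> by its slope in \<open>t\<close>.\<close>

lemma separated_hyperbola:
  fixes A P \<kappa> l K j p k0 :: real
  defines "h \<equiv> \<lambda>t s. 1 - t\<^sup>2 + A * s\<^sup>2 + 2 * P * s"
    and "k \<equiv> \<lambda>t s. \<kappa> * t\<^sup>2 + 2 * l * t * s + K * s\<^sup>2 + 2 * j * t + 2 * p * s + k0"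
  assumes neg: "k (- 1) 0 < 0" and pos: "0 < k 1 0"
    and disj: "\<And>t s. h t s = 0 \<Longrightarrow> k t s \<noteq> 0"
  shows "l = 0" "K = - \<kappa> * A" "0 < j" "(p + \<kappa> * P)\<^sup>2 \<le> j\<^sup>2 * A" "A = 0 \<Longrightarrow> P = 0"
proof -
  define q where "q s = 1 + A * s\<^sup>2 + 2 * P * s" for s
  have qc: "continuous_on I q" for I
    unfolding q_def by (intro continuous_intros)
  have kc: "continuous_on I (\<lambda>s. k (\<sigma> * sqrt (q s)) s)" for I \<sigma>
    unfolding k_def by (intro continuous_intros qc)
  \<comment> \<open>The sign \<open>\<sigma>\<close> selects the branch.\<close>
  have k_nz: "k (\<sigma> * sqrt (q s)) s \<noteq> 0" if "q s \<ge> 0" "\<sigma>\<^sup>2 = 1" for s \<sigma>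
    using that by (intro disj) (simp add: h_def power_mult_distrib, simp add: q_def)
  \<comment> \<open>If \<open>q\<close> were not positive throughout, the branches would meet at its
    first zero on the way from \<open>0\<close> to \<open>s\<close>, in the point
    \<open>(0, r * s)\<close>. Starting with opposite signs, \<open>k\<close> would reach the same
    value there along both branches and so vanish on one of them. Parametrizing by multiples of
    \<open>s\<close> treats both signs of \<open>s\<close> at once.\<close>
  have q_pos: "q s > 0" for s
  proof (rule ccontr)
    assume "\<not> q s > 0"
    then have "q (1 * s) \<le> 0" by simp
    moreover have "q (0 * s) > 0" by (simp add: q_def)
    moreover have "continuous_on {0..1} (\<lambda>t. q (t * s))"
      by (rule continuous_on_compose2[OF qc[of UNIV]]) (auto intro: continuous_intros)
    ultimately obtain r where r: "0 < r" "r \<le> 1" "q (r * s) = 0"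
      and nonneg: "\<And>t. 0 \<le> t \<Longrightarrow> t \<le> r \<Longrightarrow> 0 \<le> q (t * s)"
      using first_zero[of "\<lambda>t. q (t * s)"] by blast
    have c: "continuous_on {0..r} (\<lambda>t. k (\<sigma> * sqrt (q (t * s))) (t * s))" for \<sigma>
      by (rule continuous_on_compose2[OF kc[of UNIV]]) (auto intro: continuous_intros)
    show False
    proof (cases "k 0 (r * s) > 0")
      case True
      then obtain t where "0 \<le> t" "t \<le> r" "k ((- 1) * sqrt (q (t * s))) (t * s) = 0"
        using IVT'[of "\<lambda>t. k ((- 1) * sqrt (q (t * s))) (t * s)" 0 0 r] r neg c[of "- 1"]
        by (auto simp: q_def)
      then show False using k_nz[of "t * s" "- 1"] nonneg by simp
    next
      case False
      then obtain t where "0 \<le> t" "t \<le> r" "k (1 * sqrt (q (t * s))) (t * s) = 0"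
        using IVT2'[of "\<lambda>t. k (1 * sqrt (q (t * s))) (t * s)" r 0 0] r pos c[of 1]
        by (auto simp: q_def)
      then show False using k_nz[of "t * s" 1] nonneg by simp
    qed
  qed
  have up: "0 < k (sqrt (q s)) s" for s
    using pos_everywhere_of_no_zero[OF kc[of UNIV 1], of 0] k_nz[of _ 1] q_pos pos
    by (simp add: less_imp_le) (simp add: q_def)
  have "0 < - k (- sqrt (q s)) s" for s
    using pos_everywhere_of_no_zero[OF continuous_on_minus[OF kc[of UNIV "- 1"]], of 0]
      k_nz[of _ "- 1"] q_pos neg
    by (simp add: less_imp_le) (simp add: q_def)
  then have dn: "k (- sqrt (q s)) s < 0" for s by (simp add: neg_0_less_iff_less)
  \<comment> \<open>After substituting \<open>t\<^sup>2 = q s\<close>, \<open>r\<close> is the part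
    of \<open>k\<close> even in \<open>t\<close>; the odd part is
    \<open>t * (2 * l * s + 2 * j)\<close>.\<close>
  define r where "r s = (\<kappa> * A + K) * s\<^sup>2 + 2 * (p + \<kappa> * P) * s + (k0 + \<kappa>)" for s
  have k_eq: "k (\<sigma> * sqrt (q s)) s = r s + \<sigma> * (sqrt (q s) * (2 * l * s + 2 * j))" if "\<sigma>\<^sup>2 = 1" for s \<sigma>
    using q_pos[of s] that by (simp add: k_def r_def power_mult_distrib) (simp add: q_def algebra_simps)
  have abs_r: "\<bar>r s\<bar> < sqrt (q s) * (2 * l * s + 2 * j)" for s
    using up[of s] dn[of s] k_eq[of 1 s] k_eq[of "- 1" s] by (simp add: abs_if)
  then have "0 < sqrt (q s) * (2 * l * s + 2 * j)" for s
    by (meson abs_ge_zero le_less_trans)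
  then have "0 < 2 * l * s + 2 * j" for s
    using q_pos[of s] by (simp add: zero_less_mult_iff less_imp_le not_less) (metis order.asym q_pos real_sqrt_lt_0_iff)
  from affine_pos_everywhere[OF this] show l: "l = 0" and j: "0 < j" by auto
  have "(r s)\<^sup>2 \<le> 4 * j\<^sup>2 * A * s\<^sup>2 + 8 * j\<^sup>2 * P * s + 4 * j\<^sup>2" for s
  proof -
    have "(r s)\<^sup>2 \<le> (sqrt (q s) * (2 * j))\<^sup>2"
      using abs_r[of s] l by (intro abs_le_square_iff[THEN iffD1]) simp
    also have "\<dots> = 4 * j\<^sup>2 * q s" using q_pos[of s] by (simp add: power_mult_distrib)
    finally show ?thesis by (simp add: q_def algebra_simps)
  qed
  then have *: "((\<kappa> * A + K) * s\<^sup>2 + 2 * (p + \<kappa> * P) * s + (k0 + \<kappa>))\<^sup>2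
      \<le> 4 * j\<^sup>2 * A * s\<^sup>2 + 8 * j\<^sup>2 * P * s + 4 * j\<^sup>2" for s
    by (simp add: r_def)
  from square_quadratic_le_quadratic[OF *]
  have "\<kappa> * A + K = 0" "4 * (p + \<kappa> * P)\<^sup>2 \<le> 4 * (j\<^sup>2 * A)"
    by (simp_all only: power_mult_distrib) simp_all
  then show "K = - \<kappa> * A" "(p + \<kappa> * P)\<^sup>2 \<le> j\<^sup>2 * A" by simp_all
  show "P = 0" if "A = 0"
    using affine_pos_everywhere(1)[of "2 * P" 1] q_pos that by (simp add: q_def add.commute)
qed

section \<open>Symmetric matrices\<close>

lemma scalar_prod_self_nonneg: "0 \<le> x \<bullet> (x :: real vec)"
  by (auto simp: scalar_prod_def intro!: sum_nonneg)

lemma scalar_prod_self_eq_0_iff: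
  "x \<in> carrier_vec n \<Longrightarrow> x \<bullet> x = 0 \<longleftrightarrow> x = 0\<^sub>v n" for x :: "real vec"
proof -
  have "conjugate x = x" by (rule eq_vecI) auto
  then show "x \<in> carrier_vec n \<Longrightarrow> ?thesis" using conjugate_square_eq_0_vec[of x n] by simp
qed

lemma scalar_prod_self_pos:
  "x \<in> carrier_vec n \<Longrightarrow> x \<noteq> 0\<^sub>v n \<Longrightarrow> 0 < x \<bullet> x" for x :: "real vec"
  using scalar_prod_self_nonneg[of x] scalar_prod_self_eq_0_iff[of x n] by simp

lemma symmetric_form_commute:
  fixes M :: "'a :: comm_semiring_0 mat"
  assumes "M \<in> carrier_mat n n" "M\<^sup>T = M" "x \<in> carrier_vec n" "y \<in> carrier_vec n"
  shows "x \<bullet> (M *\<^sub>v y) = y \<bullet> (M *\<^sub>v x)"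
  using transpose_vec_mult_scalar[of M n n x y] comm_scalar_prod[of "M *\<^sub>v y" n x] assms by simp

text \<open>Each component of \<open>x\<close> is at most the norm of \<open>x\<close>, so the sum
  of the absolute values of the entries is a bound; one is added because \<open>C\<close> later
  serves as a divisor.\<close>

lemma form_bounded:
  fixes G :: "real mat"
  assumes G: "G \<in> carrier_mat n n"
  obtains C where "0 < C" "\<And>x. x \<in> carrier_vec n \<Longrightarrow> \<bar>x \<bullet> (G *\<^sub>v x)\<bar> \<le> C * (x \<bullet> x)"
proof
  define C where "C = 1 + (\<Sum>i<n. \<Sum>j<n. \<bar>G $$ (i, j)\<bar>)"
  show "0 < C" unfolding C_def by (intro add_pos_nonneg sum_nonneg) auto
  fix x :: "real vec" assume x: "x \<in> carrier_vec n"
  have comp: "\<bar>x $ i\<bar> \<le> sqrt (x \<bullet> x)" if "i < n" for i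
  proof (rule real_le_rsqrt)
    have "\<bar>x $ i\<bar>\<^sup>2 = x $ i * x $ i" by (simp add: power2_eq_square)
    also have "\<dots> \<le> x \<bullet> x"
      unfolding scalar_prod_def using x that by (intro member_le_sum) auto
    finally show "\<bar>x $ i\<bar>\<^sup>2 \<le> x \<bullet> x" .
  qed
  have "x \<bullet> (G *\<^sub>v x) = (\<Sum>i<n. \<Sum>j<n. x $ i * G $$ (i, j) * x $ j)"
    using x G by (auto simp: scalar_prod_def row_def sum_distrib_left lessThan_atLeast0 mult.assoc intro!: sum.cong)
  also have "\<bar>\<dots>\<bar> \<le> (\<Sum>i<n. \<Sum>j<n. \<bar>G $$ (i, j)\<bar> * (x \<bullet> x))"
  proof (intro order.trans[OF sum_abs] sum_mono)
    fix i j assume ij: "i \<in> {..<n}" "j \<in> {..<n}"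
    have "\<bar>x $ i\<bar> * \<bar>x $ j\<bar> \<le> sqrt (x \<bullet> x) * sqrt (x \<bullet> x)"
      using ij comp scalar_prod_self_nonneg[of x] by (intro mult_mono) auto
    then have "\<bar>x $ i\<bar> * \<bar>x $ j\<bar> \<le> x \<bullet> x" using scalar_prod_self_nonneg[of x] by simp
    from mult_left_mono[OF this, of "\<bar>G $$ (i, j)\<bar>"]
    show "\<bar>x $ i * G $$ (i, j) * x $ j\<bar> \<le> \<bar>G $$ (i, j)\<bar> * (x \<bullet> x)"
      by (simp add: abs_mult mult_ac)
  qed
  also have "\<dots> \<le> C * (x \<bullet> x)"
    using scalar_prod_self_nonneg[of x] by (simp add: C_def sum_distrib_right distrib_right)
  finally show "\<bar>x \<bullet> (G *\<^sub>v x)\<bar> \<le> C * (x \<bullet> x)" .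
qed

text \<open>The form at \<open>x\<close> is at least a multiple of the squared norm of
  \<open>M x\<close>, and an inverse \<open>N\<close> bounds that norm from below, since
  \<open>x = N (M x)\<close>. This replaces a compactness argument on the unit sphere.\<close>

lemma psd_invertible_coercive:
  fixes M :: "real mat"
  assumes M: "M \<in> carrier_mat n n" "M\<^sup>T = M"
    and psd: "\<And>x. x \<in> carrier_vec n \<Longrightarrow> 0 \<le> x \<bullet> (M *\<^sub>v x)"
    and det: "det M \<noteq> 0"
  obtains \<epsilon> where "0 < \<epsilon>" "\<And>x. x \<in> carrier_vec n \<Longrightarrow> \<epsilon> * (x \<bullet> x) \<le> x \<bullet> (M *\<^sub>v x)"
proof -
  obtain N where N: "N \<in> carrier_mat n n" "N * M = 1\<^sub>m n"
    using det_non_zero_imp_unit[OF M(1) det, of "()"] by (auto simp: Units_def ring_mat_def)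
  obtain C where C: "0 < C" "\<And>x. x \<in> carrier_vec n \<Longrightarrow> \<bar>x \<bullet> (M *\<^sub>v x)\<bar> \<le> C * (x \<bullet> x)"
    using form_bounded[OF M(1)] by blast
  obtain D where D: "0 < D" "\<And>x. x \<in> carrier_vec n \<Longrightarrow> \<bar>x \<bullet> ((N\<^sup>T * N) *\<^sub>v x)\<bar> \<le> D * (x \<bullet> x)"
    using form_bounded[of "N\<^sup>T * N" n] N(1) by (auto intro!: mult_carrier_mat)
  show ?thesis
  proof
    show "0 < 1 / (C * D)" using C D by simp
    fix x :: "real vec" assume x: "x \<in> carrier_vec n"
    define y where "y = M *\<^sub>v x"
    have y: "y \<in> carrier_vec n" using M x by (simp add: y_def)
    have My: "M *\<^sub>v y \<in> carrier_vec n" using M y by simp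
    \<comment> \<open>Nonnegativity at \<open>x - M x / C\<close> bounds the form at \<open>x\<close> by \<open>M x\<close> from below.\<close>
    define z where "z = x + (- 1 / C) \<cdot>\<^sub>v y"
    have z: "z \<in> carrier_vec n" using x y by (simp add: z_def)
    have "M *\<^sub>v z = y + (- 1 / C) \<cdot>\<^sub>v (M *\<^sub>v y)"
      using M x y by (simp add: z_def mult_add_distrib_mat_vec[of _ n n] mult_mat_vec[of _ n n]) (simp add: y_def)
    then have "z \<bullet> (M *\<^sub>v z) = x \<bullet> y - 2 / C * (y \<bullet> y) + (1 / C)\<^sup>2 * (y \<bullet> (M *\<^sub>v y))"
      using x y My symmetric_form_commute[OF M x y] comm_scalar_prod[OF x y]
      by (simp add: z_def add_scalar_prod_distrib[of _ n] scalar_prod_add_distrib[of _ n] power2_eq_square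
          flip: y_def)
    moreover have "(1 / C)\<^sup>2 * (y \<bullet> (M *\<^sub>v y)) \<le> (1 / C)\<^sup>2 * (C * (y \<bullet> y))"
      using C(2)[OF y] by (intro mult_left_mono) auto
    moreover have "(1 / C)\<^sup>2 * (C * (y \<bullet> y)) = (y \<bullet> y) / C"
      using C by (simp add: power2_eq_square)
    ultimately have lower: "(y \<bullet> y) / C \<le> x \<bullet> y"
      using psd[OF z] by simp
    have "x = N *\<^sub>v y"
      using N M x assoc_mult_mat_vec[of N n n M n x] by (simp add: y_def)
    then have "x \<bullet> x = y \<bullet> ((N\<^sup>T * N) *\<^sub>v y)"
      using N(1) y transpose_vec_mult_scalar[of "N\<^sup>T" n n "N *\<^sub>v y" y] by simp
    then have "x \<bullet> x \<le> D * (y \<bullet> y)" using D(2)[OF y] by simp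
    then have "1 / (C * D) * (x \<bullet> x) \<le> (y \<bullet> y) / C"
      using C D by (simp add: field_simps)
    then show "1 / (C * D) * (x \<bullet> x) \<le> x \<bullet> (M *\<^sub>v x)"
      using lower by (simp add: y_def)
  qed
qed

text \<open>The infimum \<open>m\<close> of the form on the unit sphere is an eigenvalue: otherwise
  \<open>M - m I\<close> is positive semidefinite and invertible, hence coercive, and
  \<open>m\<close> could be raised by \<open>\<epsilon>\<close>.\<close>

lemma symmetric_negative_eigenvalue:
  fixes M :: "real mat"
  assumes M: "M \<in> carrier_mat n n" "M\<^sup>T = M"
    and e: "e \<in> carrier_vec n" "e \<bullet> (M *\<^sub>v e) < 0"
  obtains k where "k < 0" "eigenvalue M k"
proof -
  define S where "S = {x \<bullet> (M *\<^sub>v x) | x. x \<in> carrier_vec n \<and> x \<bullet> x = 1}"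
  define m where "m = Inf S"
  obtain C where C: "0 < C" "\<And>x. x \<in> carrier_vec n \<Longrightarrow> \<bar>x \<bullet> (M *\<^sub>v x)\<bar> \<le> C * (x \<bullet> x)"
    using form_bounded[OF M(1)] by blast
  have bdd: "bdd_below S"
  proof (rule bdd_belowI[of _ "- C"])
    fix s assume "s \<in> S"
    then obtain x where "x \<in> carrier_vec n" "x \<bullet> x = 1" "s = x \<bullet> (M *\<^sub>v x)"
      by (auto simp: S_def)
    then show "- C \<le> s" using C(2)[of x] by simp
  qed
  have normalize: "(x \<bullet> (M *\<^sub>v x)) / (x \<bullet> x) \<in> S" if x: "x \<in> carrier_vec n" "x \<noteq> 0\<^sub>v n" for x
  proof -
    define c where "c = 1 / sqrt (x \<bullet> x)"
    have c: "c * c = 1 / (x \<bullet> x)"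
      using scalar_prod_self_pos[OF x] by (simp add: c_def)
    have "(c \<cdot>\<^sub>v x) \<bullet> (M *\<^sub>v (c \<cdot>\<^sub>v x)) = (c * c) * (x \<bullet> (M *\<^sub>v x))"
      using x M by (simp add: mult_mat_vec[of _ n n] mult.assoc)
    moreover have "(c \<cdot>\<^sub>v x) \<bullet> (c \<cdot>\<^sub>v x) = (c * c) * (x \<bullet> x)"
      using x by (simp add: mult.assoc)
    ultimately show ?thesis
      using x scalar_prod_self_pos[OF x] unfolding S_def
      by (intro CollectI exI[of _ "c \<cdot>\<^sub>v x"]) (simp add: c)
  qed
  have e0: "e \<noteq> 0\<^sub>v n" using e M by auto
  have m_le: "m * (x \<bullet> x) \<le> x \<bullet> (M *\<^sub>v x)" if x: "x \<in> carrier_vec n" for x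
  proof (cases "x = 0\<^sub>v n")
    case True then show ?thesis using M by simp
  next
    case False
    then show ?thesis
      using cInf_lower[OF normalize[OF x False] bdd] scalar_prod_self_pos[OF x False]
      by (simp add: m_def field_simps)
  qed
  have "m < 0"
  proof -
    have "m * (e \<bullet> e) < 0" using m_le[OF e(1)] e(2) by simp
    then show ?thesis using scalar_prod_self_pos[OF e(1) e0] by (simp add: mult_less_0_iff)
  qed
  moreover have "eigenvalue M m"
  proof (rule ccontr)
    let ?M = "char_matrix M m"
    assume "\<not> eigenvalue M m"
    then have det: "det ?M \<noteq> 0" using eigenvalue_det[OF M(1)] by simp
    let ?D = "(- m) \<cdot>\<^sub>m 1\<^sub>m n"
    have D: "?D \<in> carrier_mat n n" "?D\<^sup>T = ?D" by (auto intro!: eq_matI)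
    have "?M = M + ?D" using M(1) by (simp add: char_matrix_def)
    then have M': "?M \<in> carrier_mat n n" "?M\<^sup>T = ?M"
      using M D transpose_add[OF M(1) D(1)] by simp_all
    have form: "x \<bullet> (?M *\<^sub>v x) = x \<bullet> (M *\<^sub>v x) - m * (x \<bullet> x)" if "x \<in> carrier_vec n" for x
    proof -
      have "?M *\<^sub>v x = M *\<^sub>v x + (- m) \<cdot>\<^sub>v x"
        using M that by (intro eq_vecI) (auto simp: char_matrix_def add_scalar_prod_distrib[of _ n])
      then show ?thesis using M that by (simp add: scalar_prod_add_distrib[of _ n])
    qed
    obtain \<epsilon> where \<epsilon>: "0 < \<epsilon>" "\<And>x. x \<in> carrier_vec n \<Longrightarrow> \<epsilon> * (x \<bullet> x) \<le> x \<bullet> (?M *\<^sub>v x)"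
    proof (rule psd_invertible_coercive[OF M' _ det])
      show "0 \<le> x \<bullet> (?M *\<^sub>v x)" if "x \<in> carrier_vec n" for x
        using m_le[OF that] form[OF that] by simp
    qed blast
    have "m + \<epsilon> \<le> m"
      unfolding m_def
    proof (rule cInf_greatest)
      show "S \<noteq> {}" using normalize[OF e(1) e0] by auto
      fix s assume "s \<in> S"
      then obtain x where "x \<in> carrier_vec n" "x \<bullet> x = 1" "s = x \<bullet> (M *\<^sub>v x)"
        by (auto simp: S_def)
      then show "Inf S + \<epsilon> \<le> s" using \<epsilon>(2)[of x] form[of x] by (simp add: m_def)
    qed
    then show False using \<epsilon>(1) by simp
  qed
  ultimately show ?thesis using that by blast
qed

section \<open>Counting negative eigenvalues\<close>

lemma neg_eigenvalue_count_pos: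
  assumes M: "M \<in> carrier_mat n n" and k: "k < 0" "eigenvalue M k"
  shows "0 < neg_eigenvalue_count M"
proof -
  have "char_poly M \<noteq> 0" using degree_monic_char_poly[OF M] by auto
  then have "k \<in># {# e \<in># proots (char_poly M). e < 0 #}"
    using k eigenvalue_root_char_poly[OF M] by simp
  then show ?thesis unfolding neg_eigenvalue_count_def by (metis empty_iff gr0I set_mset_empty size_eq_0_iff_empty)
qed

lemma neg_eigenvalue_count_posD:
  assumes M: "M \<in> carrier_mat n n" and pos: "0 < neg_eigenvalue_count M"
  obtains k where "k < 0" "eigenvalue M k"
proof -
  obtain k where "k \<in># {# e \<in># proots (char_poly M). e < 0 #}"
    using pos unfolding neg_eigenvalue_count_def by (metis gr_implies_not0 multiset_nonemptyE size_empty)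
  moreover have "char_poly M \<noteq> 0" using degree_monic_char_poly[OF M] by auto
  ultimately have "k < 0" "poly (char_poly M) k = 0" by simp_all
  then show ?thesis using that eigenvalue_root_char_poly[OF M] by blast
qed

text \<open>For the real part \<open>x\<close> and the imaginary part \<open>y\<close> of an
  eigenvector, symmetry equates \<open>x \<bullet> (M *\<^sub>v y)\<close> and
  \<open>y \<bullet> (M *\<^sub>v x)\<close>; their difference is \<open>Im k\<close> times the
  squared norm of the eigenvector.\<close>

lemma symmetric_complex_eigenvalue_real:
  fixes M :: "real mat"
  assumes M: "M \<in> carrier_mat n n" "M\<^sup>T = M"
    and ev: "eigenvalue (map_mat complex_of_real M) k"
  shows "Im k = 0"
proof -
  let ?Mc = "map_mat complex_of_real M"
  obtain v where v: "v \<in> carrier_vec n" "v \<noteq> 0\<^sub>v n" "?Mc *\<^sub>v v = k \<cdot>\<^sub>v v"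
    using ev M by (auto simp: eigenvalue_def eigenvector_def)
  define x where "x = map_vec Re v"
  define y where "y = map_vec Im v"
  have xy: "x \<in> carrier_vec n" "y \<in> carrier_vec n" using v by (auto simp: x_def y_def)
  have comp: "(?Mc *\<^sub>v v) $ i = Complex ((M *\<^sub>v x) $ i) ((M *\<^sub>v y) $ i)" if "i < n" for i
    using that M(1) v(1) by (auto simp: complex_eq_iff scalar_prod_def x_def y_def)
  have Mx: "M *\<^sub>v x = Re k \<cdot>\<^sub>v x + (- Im k) \<cdot>\<^sub>v y"
  proof (rule eq_vecI)
    fix i assume "i < dim_vec (Re k \<cdot>\<^sub>v x + (- Im k) \<cdot>\<^sub>v y)"
    then have i: "i < n" using xy by simp
    show "(M *\<^sub>v x) $ i = (Re k \<cdot>\<^sub>v x + (- Im k) \<cdot>\<^sub>v y) $ i"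
      using arg_cong[OF comp[OF i], of Re] i xy v by (simp add: v(3)) (simp add: x_def y_def)
  qed (use M xy in auto)
  have My: "M *\<^sub>v y = Re k \<cdot>\<^sub>v y + Im k \<cdot>\<^sub>v x"
  proof (rule eq_vecI)
    fix i assume "i < dim_vec (Re k \<cdot>\<^sub>v y + Im k \<cdot>\<^sub>v x)"
    then have i: "i < n" using xy by simp
    show "(M *\<^sub>v y) $ i = (Re k \<cdot>\<^sub>v y + Im k \<cdot>\<^sub>v x) $ i"
      using arg_cong[OF comp[OF i], of Im] i xy v by (simp add: v(3)) (simp add: x_def y_def)
  qed (use M xy in auto)
  have "Im k * (x \<bullet> x + y \<bullet> y) = 0"
    using symmetric_form_commute[OF M xy] xy comm_scalar_prod[OF xy]
    by (simp add: Mx My scalar_prod_add_distrib[of _ n] algebra_simps)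
  moreover have "x \<noteq> 0\<^sub>v n \<or> y \<noteq> 0\<^sub>v n"
  proof (rule ccontr)
    assume "\<not> ?thesis"
    then have "Re (v $ i) = 0" "Im (v $ i) = 0" if "i < n" for i
      using that v(1) by (auto simp: x_def y_def vec_eq_iff)
    then show False using v(1,2) by (auto simp: vec_eq_iff complex_eq_iff)
  qed
  then have "x \<bullet> x + y \<bullet> y > 0"
    using scalar_prod_self_pos[OF xy(1)] scalar_prod_self_pos[OF xy(2)]
      scalar_prod_self_nonneg[of x] scalar_prod_self_nonneg[of y] by force
  ultimately show ?thesis by simp
qed

text \<open>The linear factors over the complex numbers have real roots, and the embedding of real
  polynomials is injective. The list of real roots is what a real Schur decomposition takes as
  input.\<close>

lemma symmetric_char_poly_splits:
  fixes M :: "real mat"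
  assumes M: "M \<in> carrier_mat n n" "M\<^sup>T = M"
  obtains es where "char_poly M = (\<Prod>e\<leftarrow>es. [:- e, 1:])"
proof -
  let ?Mc = "map_mat complex_of_real M"
  interpret h: map_poly_inj_comm_ring_hom complex_of_real ..
  have Mc: "?Mc \<in> carrier_mat n n" using M by simp
  obtain as where as: "char_poly ?Mc = (\<Prod>a\<leftarrow>as. [:- a, 1:])"
    using char_poly_factorized[OF Mc] by blast
  have "of_real (Re a) = a" if "a \<in> set as" for a
  proof -
    have "poly (char_poly ?Mc) a = 0" using that by (auto simp: as poly_prod_list prod_list_zero_iff)
    then show ?thesis
      using symmetric_complex_eigenvalue_real[OF M] eigenvalue_root_char_poly[OF Mc] by (simp add: complex_eq_iff)
  qed
  then have "map_poly complex_of_real (\<Prod>e\<leftarrow>map Re as. [:- e, 1:]) = (\<Prod>a\<leftarrow>as. [:- a, 1:])"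
    by (simp add: h.hom_prod_list o_def cong: map_cong)
  also have "\<dots> = map_poly complex_of_real (char_poly M)"
    by (simp add: of_real_hom.char_poly_hom[OF M(1)] flip: as)
  finally have "char_poly M = (\<Prod>e\<leftarrow>map Re as. [:- e, 1:])"
    by (simp only: h.eq_iff)
  then show ?thesis by (rule that)
qed

text \<open>A Schur decomposition realizes any prescribed order of the roots on the diagonal, so a
  repeated negative eigenvalue is treated like two distinct ones.\<close>

lemma neg_eigenvalue_count_le_1:
  fixes M :: "real mat"
  assumes M: "M \<in> carrier_mat n n" "M\<^sup>T = M" and u: "u \<in> carrier_vec n"
    and psd: "\<And>x. x \<in> carrier_vec n \<Longrightarrow> u \<bullet> x = 0 \<Longrightarrow> 0 \<le> x \<bullet> (M *\<^sub>v x)"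
  shows "neg_eigenvalue_count M \<le> 1"
proof (rule ccontr)
  assume "\<not> ?thesis"
  then have "2 \<le> size {# e \<in># proots (char_poly M). e < 0 #}"
    by (simp add: neg_eigenvalue_count_def)
  moreover obtain es where es: "char_poly M = (\<Prod>e\<leftarrow>es. [:- e, 1:])"
    using symmetric_char_poly_splits[OF M] by blast
  have "proots (char_poly M) = mset es"
    unfolding es
  proof (induction es)
    case (Cons e es)
    have "(\<Prod>e\<leftarrow>es. [:- e, 1:]) \<noteq> 0" by (auto simp: prod_list_zero_iff)
    then show ?case
      using Cons by (simp add: proots_mult del: mult_pCons_left)
  qed simp
  ultimately have "2 \<le> length (filter (\<lambda>e. e < 0) es)" by (simp flip: mset_filter)
  then obtain e1 e2 fs where fs: "filter (\<lambda>e. e < 0) es = e1 # e2 # fs"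
    by (metis One_nat_def Suc_1 Suc_le_length_iff)
  \<comment> \<open>With two negative eigenvalues listed first, the leading Schur vectors span an invariant plane
    on which the form is negative definite; that plane meets the hyperplane orthogonal to \<open>u\<close>.\<close>
  define gs where "gs = e1 # e2 # (fs @ filter (\<lambda>e. \<not> e < 0) es)"
  have neg: "e1 < 0" "e2 < 0"
    using arg_cong[OF fs, of set] by auto
  have "mset gs = mset es"
    using multiset_partition[of "mset es" "\<lambda>e. e < 0"] by (simp add: gs_def fs flip: mset_filter)
  then have gs: "char_poly M = (\<Prod>e\<leftarrow>gs. [:- e, 1:])"
    unfolding es by (metis mset_map prod_mset_prod_list)
  obtain B P Q where BPQ: "schur_decomposition M gs = (B, P, Q)"
    using prod_cases3 by blast
  from schur_decomposition[OF M(1) gs BPQ]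
  have sim: "similar_mat_wit M B P Q" and tri: "upper_triangular B" and diag: "diag_mat B = gs"
    by auto
  have carr: "B \<in> carrier_mat n n" "P \<in> carrier_mat n n" "Q \<in> carrier_mat n n"
    and QP: "Q * P = 1\<^sub>m n" and MPBQ: "M = P * B * Q"
    using sim M(1) by (auto simp: similar_mat_wit_def Let_def)
  have "2 \<le> n"
    using arg_cong[OF diag, of length] carr by (simp add: diag_mat_def gs_def)
  then have n: "0 < n" "1 < n" by auto
  have B: "B $$ (0, 0) = e1" "B $$ (1, 1) = e2"
    using arg_cong[OF diag, of "\<lambda>l. l ! 0"] arg_cong[OF diag, of "\<lambda>l. l ! 1"] carr \<open>2 \<le> n\<close>
    by (simp_all add: diag_mat_def gs_def)
  have B0: "B $$ (i, j) = 0" if "j < i" "i < n" for i j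
    using tri carr that by auto
  have MP: "M *\<^sub>v (P *\<^sub>v x) = P *\<^sub>v (B *\<^sub>v x)" if "x \<in> carrier_vec n" for x
  proof -
    have "M *\<^sub>v (P *\<^sub>v x) = P *\<^sub>v (B *\<^sub>v (Q *\<^sub>v (P *\<^sub>v x)))"
      using that carr unfolding MPBQ
      by (simp add: assoc_mult_mat_vec[of _ n n _ n] del: assoc_mult_mat)
    moreover have "Q *\<^sub>v (P *\<^sub>v x) = x"
      using assoc_mult_mat_vec[OF carr(3,2) that] QP that by simp
    ultimately show ?thesis by simp
  qed
  define p where "p = P *\<^sub>v unit_vec n 0"
  define r where "r = P *\<^sub>v unit_vec n 1"
  have pr: "p \<in> carrier_vec n" "r \<in> carrier_vec n" using carr by (auto simp: p_def r_def)
  have inj: "P *\<^sub>v x \<noteq> 0\<^sub>v n" if "x \<in> carrier_vec n" "x \<noteq> 0\<^sub>v n" for x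
  proof
    assume "P *\<^sub>v x = 0\<^sub>v n"
    then have "(Q * P) *\<^sub>v x = 0\<^sub>v n"
      using assoc_mult_mat_vec[OF carr(3,2) that(1)] carr by (auto intro!: eq_vecI)
    then show False using QP that by simp
  qed
  have "B *\<^sub>v unit_vec n 0 = e1 \<cdot>\<^sub>v unit_vec n 0"
    using carr n B B0[of 0] by (intro eq_vecI) auto
  then have Mp: "M *\<^sub>v p = e1 \<cdot>\<^sub>v p"
    using carr by (simp add: p_def MP mult_mat_vec[of _ n n])
  have "B *\<^sub>v unit_vec n 1 = B $$ (0, 1) \<cdot>\<^sub>v unit_vec n 0 + e2 \<cdot>\<^sub>v unit_vec n 1"
    using carr n B B0[of 1] by (intro eq_vecI) (auto simp: nat_neq_iff)
  then have Mr: "M *\<^sub>v r = B $$ (0, 1) \<cdot>\<^sub>v p + e2 \<cdot>\<^sub>v r"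
    using carr by (simp add: p_def r_def MP mult_mat_vec[of _ n n] mult_add_distrib_mat_vec[of _ n n])
  have p0: "p \<bullet> p > 0"
    using inj[of "unit_vec n 0"] \<open>2 \<le> n\<close> pr by (intro scalar_prod_self_pos) (auto simp: p_def)
  \<comment> \<open>Of \<open>P\<close> only invertibility is at hand, so the second vector is
    orthogonalized against \<open>p\<close> explicitly. The \<open>p\<close>-component of
    \<open>M w\<close> then drops out of products with \<open>w\<close>, and the form becomes
    diagonal in \<open>p\<close> and \<open>w\<close>.\<close>
  define s where "s = - (p \<bullet> r) / (p \<bullet> p)"
  define w where "w = r + s \<cdot>\<^sub>v p"
  have w: "w \<in> carrier_vec n" using pr by (simp add: w_def)
  have pw: "p \<bullet> w = 0"
    using pr p0 by (simp add: w_def scalar_prod_add_distrib[of _ n] s_def)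
  have "w = P *\<^sub>v (unit_vec n 1 + s \<cdot>\<^sub>v unit_vec n 0)"
    using carr by (simp add: w_def r_def p_def mult_mat_vec[of _ n n] mult_add_distrib_mat_vec[of _ n n])
  moreover have "unit_vec n 1 + s \<cdot>\<^sub>v unit_vec n 0 \<noteq> 0\<^sub>v n"
  proof
    assume "unit_vec n 1 + s \<cdot>\<^sub>v unit_vec n 0 = 0\<^sub>v n"
    from arg_cong[OF this, of "\<lambda>v. v $ 1"] show False using \<open>2 \<le> n\<close> by simp
  qed
  ultimately have w0: "w \<bullet> w > 0"
    using inj w by (intro scalar_prod_self_pos) auto
  have "M *\<^sub>v w = (B $$ (0, 1) + s * e1 - e2 * s) \<cdot>\<^sub>v p + e2 \<cdot>\<^sub>v w"
  proof -
    have "M *\<^sub>v w = B $$ (0, 1) \<cdot>\<^sub>v p + e2 \<cdot>\<^sub>v r + s \<cdot>\<^sub>v (e1 \<cdot>\<^sub>v p)"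
      using M pr by (simp add: w_def mult_mat_vec[of _ n n] mult_add_distrib_mat_vec[of _ n n] Mp Mr)
    also have "\<dots> = (B $$ (0, 1) + s * e1 - e2 * s) \<cdot>\<^sub>v p + e2 \<cdot>\<^sub>v w"
      using pr by (intro eq_vecI) (auto simp: w_def algebra_simps)
    finally show ?thesis .
  qed
  then have ww: "w \<bullet> (M *\<^sub>v w) = e2 * (w \<bullet> w)"
    using pr w pw comm_scalar_prod[OF pr(1) w] by (simp add: scalar_prod_add_distrib[of _ n])
  have wp: "w \<bullet> (M *\<^sub>v p) = 0" "p \<bullet> (M *\<^sub>v w) = 0" "p \<bullet> (M *\<^sub>v p) = e1 * (p \<bullet> p)"
    using pr w pw comm_scalar_prod[OF pr(1) w] symmetric_form_commute[OF M pr(1) w] by (simp_all add: Mp)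
  have form: "(\<alpha> \<cdot>\<^sub>v p + \<beta> \<cdot>\<^sub>v w) \<bullet> (M *\<^sub>v (\<alpha> \<cdot>\<^sub>v p + \<beta> \<cdot>\<^sub>v w))
      = \<alpha>\<^sup>2 * (e1 * (p \<bullet> p)) + \<beta>\<^sup>2 * (e2 * (w \<bullet> w))" for \<alpha> \<beta>
  proof -
    have "M *\<^sub>v p \<in> carrier_vec n" "M *\<^sub>v w \<in> carrier_vec n" using M pr w by auto
    then show ?thesis
      using M pr w wp ww
      by (simp add: mult_mat_vec[of _ n n] mult_add_distrib_mat_vec[of _ n n] add_scalar_prod_distrib[of _ n]
        scalar_prod_add_distrib[of _ n] power2_eq_square)
  qed
  have "\<exists>\<alpha> \<beta>. \<alpha> * (u \<bullet> p) + \<beta> * (u \<bullet> w) = 0 \<and> (\<alpha> \<noteq> 0 \<or> \<beta> \<noteq> 0)"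
  proof (cases "u \<bullet> p = 0")
    case True then show ?thesis by (intro exI[of _ 1] exI[of _ 0]) simp
  next
    case False then show ?thesis by (intro exI[of _ "- (u \<bullet> w)"] exI[of _ "u \<bullet> p"]) simp
  qed
  then obtain \<alpha> \<beta> where ab: "\<alpha> * (u \<bullet> p) + \<beta> * (u \<bullet> w) = 0" "\<alpha> \<noteq> 0 \<or> \<beta> \<noteq> 0" by blast
  have "0 \<le> \<alpha>\<^sup>2 * (e1 * (p \<bullet> p)) + \<beta>\<^sup>2 * (e2 * (w \<bullet> w))"
    using psd[of "\<alpha> \<cdot>\<^sub>v p + \<beta> \<cdot>\<^sub>v w"] u pr w ab(1) by (simp add: scalar_prod_add_distrib[of _ n] form)
  moreover have "\<alpha>\<^sup>2 * (e1 * (p \<bullet> p)) \<le> 0" "\<beta>\<^sup>2 * (e2 * (w \<bullet> w)) \<le> 0"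
    using neg p0 w0 by (simp_all add: mult_nonneg_nonpos mult_neg_pos less_imp_le)
  ultimately have "\<alpha>\<^sup>2 * (e1 * (p \<bullet> p)) = 0" "\<beta>\<^sup>2 * (e2 * (w \<bullet> w)) = 0" by linarith+
  then show False using ab(2) neg p0 w0 by simp
qed

section \<open>Orthogonal projection and the range of a symmetric matrix\<close>

lemma mem_range_space_iff:
  fixes A :: "real mat"
  assumes "A \<in> carrier_mat n m"
  shows "y \<in> range_space A \<longleftrightarrow> (\<exists>x \<in> carrier_vec m. A *\<^sub>v x = y)"
  unfolding range_space_def using assms vec_space.col_space_eq[of A n m] by auto

text \<open>
  Instead of linear combinations of \<open>vs\<close>, the statement says that \<open>p\<close> lies in a subspace containing
  \<open>vs\<close> and in the double orthogonal complement of \<open>vs\<close>; the latter carries the induction.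
\<close>

lemma projection_exists:
  fixes S :: "real vec set"
  assumes S: "S \<subseteq> carrier_vec n" "0\<^sub>v n \<in> S"
    and comb: "\<And>x y c. x \<in> S \<Longrightarrow> y \<in> S \<Longrightarrow> x + c \<cdot>\<^sub>v y \<in> S"
  shows "set vs \<subseteq> S \<Longrightarrow> u \<in> carrier_vec n \<Longrightarrow>
    \<exists>p \<in> S. (\<forall>v \<in> set vs. v \<bullet> p = v \<bullet> u) \<and>
      (\<forall>y \<in> carrier_vec n. (\<forall>v \<in> set vs. v \<bullet> y = 0) \<longrightarrow> p \<bullet> y = 0)"
proof (induction vs arbitrary: u)
  case Nil then show ?case using S by (intro bexI[of _ "0\<^sub>v n"]) auto
next
  case (Cons v vs)
  have v: "v \<in> S" "v \<in> carrier_vec n" using Cons.prems S by auto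
  have vs: "w \<in> carrier_vec n" if "w \<in> set vs" for w using Cons.prems S that by auto
  obtain p where p: "p \<in> S" "\<And>w. w \<in> set vs \<Longrightarrow> w \<bullet> p = w \<bullet> u"
    "\<And>y. y \<in> carrier_vec n \<Longrightarrow> (\<And>w. w \<in> set vs \<Longrightarrow> w \<bullet> y = 0) \<Longrightarrow> p \<bullet> y = 0"
    using Cons.IH[of u] Cons.prems by auto
  obtain q where q: "q \<in> S" "\<And>w. w \<in> set vs \<Longrightarrow> w \<bullet> q = w \<bullet> v"
    "\<And>y. y \<in> carrier_vec n \<Longrightarrow> (\<And>w. w \<in> set vs \<Longrightarrow> w \<bullet> y = 0) \<Longrightarrow> q \<bullet> y = 0"
    using Cons.IH[of v] Cons.prems v by auto
  have pq: "p \<in> carrier_vec n" "q \<in> carrier_vec n" using p q S by auto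
  \<comment> \<open>The component of \<open>v\<close> orthogonal to \<open>vs\<close>: adding a
    multiple of it corrects the product with \<open>v\<close> and leaves the products with
    \<open>vs\<close> unchanged.\<close>
  define r where "r = v + (- 1) \<cdot>\<^sub>v q"
  have r: "r \<in> S" "r \<in> carrier_vec n" using comb v q pq by (simp_all add: r_def)
  have r_perp: "w \<bullet> r = 0" if "w \<in> set vs" for w
    using vs that q v pq by (simp add: r_def scalar_prod_add_distrib[of _ n])
  have qr: "q \<bullet> r = 0" using q(3)[OF r(2)] r_perp by simp
  have vr: "v \<bullet> r = r \<bullet> r"
  proof -
    have "r \<bullet> r = v \<bullet> r - q \<bullet> r"
      using v pq r(2) by (subst r_def) (simp add: add_scalar_prod_distrib[of _ n])
    then show ?thesis using qr by simp
  qed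
  define c where "c = (v \<bullet> u - v \<bullet> p) / (r \<bullet> r)"
  let ?p = "p + c \<cdot>\<^sub>v r"
  have vp: "v \<bullet> ?p = v \<bullet> u"
  proof (cases "r = 0\<^sub>v n")
    case False
    then show ?thesis
      using scalar_prod_self_pos[OF r(2)] v pq r by (simp add: scalar_prod_add_distrib[of _ n] vr c_def)
  next
    case True
    \<comment> \<open>Now \<open>v = q\<close> is orthogonal to everything orthogonal to
      \<open>vs\<close>, in particular to \<open>u - p\<close>, so the product of \<open>v\<close>
      with \<open>p\<close> is already right.\<close>
    have "v = r + q" using v pq by (intro eq_vecI) (auto simp: r_def)
    then have "v = q" using True pq by simp
    have y: "u + (- 1) \<cdot>\<^sub>v p \<in> carrier_vec n" using Cons.prems pq by simp
    have "q \<bullet> (u + (- 1) \<cdot>\<^sub>v p) = 0"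
      using vs Cons.prems pq p by (intro q(3)[OF y]) (simp add: scalar_prod_add_distrib[of _ n])
    then show ?thesis
      using True Cons.prems pq \<open>v = q\<close> by (simp add: scalar_prod_add_distrib[of _ n])
  qed
  show ?case
  proof (intro bexI[of _ ?p] conjI ballI impI)
    show "?p \<in> S" using comb p r by simp
    fix w assume "w \<in> set (v # vs)"
    then show "w \<bullet> ?p = w \<bullet> u"
      using vp vs pq r p(2) r_perp by (auto simp: scalar_prod_add_distrib[of _ n])
  next
    fix y assume y: "y \<in> carrier_vec n" "\<forall>w \<in> set (v # vs). w \<bullet> y = 0"
    then have "r \<bullet> y = 0"
      using v pq q(3)[of y] by (simp add: r_def add_scalar_prod_distrib[of _ n])
    then show "?p \<bullet> y = 0"
      using y pq r p(3)[of y] by (simp add: add_scalar_prod_distrib[of _ n])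
  qed
qed

text \<open>Project \<open>u\<close> onto the range. The residual \<open>y\<close> is orthogonal to
  all columns, which are also the rows, so it lies in the kernel. It is then orthogonal to
  \<open>u\<close> by assumption and to the projection by symmetry, hence to itself.\<close>

lemma symmetric_range_of_kernel_orthogonal:
  fixes A :: "real mat"
  assumes A: "A \<in> carrier_mat n n" "A\<^sup>T = A" and u: "u \<in> carrier_vec n"
    and perp: "\<And>v. v \<in> carrier_vec n \<Longrightarrow> A *\<^sub>v v = 0\<^sub>v n \<Longrightarrow> u \<bullet> v = 0"
  shows "u \<in> range_space A"
proof -
  let ?S = "{A *\<^sub>v x | x. x \<in> carrier_vec n}"
  have "\<exists>p \<in> ?S. (\<forall>v \<in> set (cols A). v \<bullet> p = v \<bullet> u) \<and>
      (\<forall>y \<in> carrier_vec n. (\<forall>v \<in> set (cols A). v \<bullet> y = 0) \<longrightarrow> p \<bullet> y = 0)"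
  proof (rule projection_exists[OF _ _ _ _ u])
    show "?S \<subseteq> carrier_vec n" using A by auto
    show "0\<^sub>v n \<in> ?S" using A by (auto intro!: exI[of _ "0\<^sub>v n"])
    show "x + c \<cdot>\<^sub>v y \<in> ?S" if "x \<in> ?S" "y \<in> ?S" for x y c
    proof -
      obtain x' y' where "x' \<in> carrier_vec n" "y' \<in> carrier_vec n" "x = A *\<^sub>v x'" "y = A *\<^sub>v y'"
        using \<open>x \<in> ?S\<close> \<open>y \<in> ?S\<close> by auto
      then show ?thesis
        using A by (auto intro!: exI[of _ "x' + c \<cdot>\<^sub>v y'"]
          simp: mult_mat_vec[of _ n n] mult_add_distrib_mat_vec[of _ n n])
    qed
    show "set (cols A) \<subseteq> ?S"
    proof
      fix v assume "v \<in> set (cols A)"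
      then obtain j where "j < n" "v = col A j" using A by (auto simp: cols_def)
      moreover have "A *\<^sub>v unit_vec n j = col A j"
        using A \<open>j < n\<close> by (intro eq_vecI) auto
      ultimately show "v \<in> ?S" by (metis (mono_tags, lifting) mem_Collect_eq unit_vec_carrier)
    qed
  qed
  then obtain x where x: "x \<in> carrier_vec n" "\<And>v. v \<in> set (cols A) \<Longrightarrow> v \<bullet> (A *\<^sub>v x) = v \<bullet> u"
    by auto
  define y where "y = u + (- 1) \<cdot>\<^sub>v (A *\<^sub>v x)"
  have Ax: "A *\<^sub>v x \<in> carrier_vec n" using A x by simp
  have y: "y \<in> carrier_vec n" using u Ax by (simp add: y_def)
  have "A *\<^sub>v y = 0\<^sub>v n"
  proof (rule eq_vecI)
    fix i assume "i < dim_vec (0\<^sub>v n :: real vec)"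
    then have i: "i < n" by simp
    then have "row A i = col A i" using A by (metis carrier_matD(2) row_transpose)
    moreover have "col A i \<in> set (cols A)" using A i by (auto simp: cols_def)
    ultimately show "(A *\<^sub>v y) $ i = 0\<^sub>v n $ i"
      using A u Ax i x(2)[of "col A i"] col_carrier_vec[OF i A(1)]
      by (simp add: y_def scalar_prod_add_distrib[of _ n])
  qed (use A in auto)
  then have "u \<bullet> y = 0" "(A *\<^sub>v x) \<bullet> y = 0"
    using perp[OF y] symmetric_form_commute[OF A y x(1)] comm_scalar_prod[OF Ax y] x by auto
  then have "y \<bullet> y = 0"
    using u Ax y by (subst y_def) (simp add: add_scalar_prod_distrib[of _ n])
  then have "y = 0\<^sub>v n" using scalar_prod_self_eq_0_iff[OF y] by simp
  have "A *\<^sub>v x = u"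
  proof (rule eq_vecI)
    fix i assume "i < dim_vec u"
    then have i: "i < n" using u by simp
    have "y $ i = u $ i - (A *\<^sub>v x) $ i" using i u A by (simp add: y_def)
    then show "(A *\<^sub>v x) $ i = u $ i" using i \<open>y = 0\<^sub>v n\<close> by simp
  qed (use A u in auto)
  then show ?thesis using mem_range_space_iff[OF A(1)] x by blast
qed

section \<open>Separated quadrics\<close>

lemma smult_zero_vec_right [simp]: "c \<cdot>\<^sub>v 0\<^sub>v n = (0\<^sub>v n :: real vec)"
  by (intro eq_vecI) auto

lemma symmetric_form_add_smult:
  fixes M :: "real mat"
  assumes "M \<in> carrier_mat n n" "M\<^sup>T = M" "x \<in> carrier_vec n" "y \<in> carrier_vec n"
  shows "(t \<cdot>\<^sub>v x + y) \<bullet> (M *\<^sub>v (t \<cdot>\<^sub>v x + y))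
    = t\<^sup>2 * (x \<bullet> (M *\<^sub>v x)) + 2 * t * (x \<bullet> (M *\<^sub>v y)) + y \<bullet> (M *\<^sub>v y)"
proof -
  have "M *\<^sub>v x \<in> carrier_vec n" "M *\<^sub>v y \<in> carrier_vec n" using assms by auto
  then show ?thesis
    using assms(1,3,4) symmetric_form_commute[OF assms]
    by (simp add: mult_mat_vec[of _ n n] mult_add_distrib_mat_vec[of _ n n] add_scalar_prod_distrib[of _ n]
        scalar_prod_add_distrib[of _ n] power2_eq_square algebra_simps)
qed

text \<open>Polarization at pairs of unit vectors recovers the entries.\<close>

lemma symmetric_eq_of_form_eq:
  fixes M N :: "real mat"
  assumes M: "M \<in> carrier_mat n n" "M\<^sup>T = M" and N: "N \<in> carrier_mat n n" "N\<^sup>T = N"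
    and eq: "\<And>x. x \<in> carrier_vec n \<Longrightarrow> x \<bullet> (M *\<^sub>v x) = x \<bullet> (N *\<^sub>v x)"
  shows "M = N"
proof (rule eq_matI)
  fix i j assume "i < dim_row N" "j < dim_col N"
  then have ij: "i < n" "j < n" using N by auto
  have entry: "unit_vec n i \<bullet> (X *\<^sub>v unit_vec n j) = X $$ (i, j)" if "X \<in> carrier_mat n n" for X :: "real mat"
    using ij that by simp
  let ?v = "1 \<cdot>\<^sub>v unit_vec n i + unit_vec n j :: real vec"
  have "?v \<bullet> (M *\<^sub>v ?v) = ?v \<bullet> (N *\<^sub>v ?v)" by (intro eq) simp
  then have "unit_vec n i \<bullet> (M *\<^sub>v unit_vec n j) = unit_vec n i \<bullet> (N *\<^sub>v unit_vec n j)"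
    using eq[of "unit_vec n i"] eq[of "unit_vec n j"]
    unfolding symmetric_form_add_smult[OF M unit_vec_carrier unit_vec_carrier]
      symmetric_form_add_smult[OF N unit_vec_carrier unit_vec_carrier] by simp
  then show "M $$ (i, j) = N $$ (i, j)" using entry M N by simp
qed (use M N in auto)

lemma quadratic_fun_expand:
  assumes M: "M \<in> carrier_mat n n" "M\<^sup>T = M" and g: "g \<in> carrier_vec n"
    and m: "m \<in> carrier_vec n" and z: "z \<in> carrier_vec n"
  shows "quadratic_fun M g c (m + z)
    = quadratic_fun M g c m + z \<bullet> (M *\<^sub>v z) + 2 * (z \<bullet> (M *\<^sub>v m + g))"
proof -
  have Mm: "M *\<^sub>v m \<in> carrier_vec n" using M m by simp
  have "quadratic_fun M g c (m + z) = quadratic_fun M g c (1 \<cdot>\<^sub>v m + z)" by simp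
  also have "\<dots> = quadratic_fun M g c m + z \<bullet> (M *\<^sub>v z) + 2 * (z \<bullet> (M *\<^sub>v m + g))"
    unfolding quadratic_fun_def symmetric_form_add_smult[OF M m z]
    using Mm g m z symmetric_form_commute[OF M m z] comm_scalar_prod[OF g z]
    by (simp add: scalar_prod_add_distrib[of _ n])
  finally show ?thesis .
qed

lemma quadratic_fun_expand_plane:
  assumes M: "M \<in> carrier_mat n n" "M\<^sup>T = M" and g: "g \<in> carrier_vec n"
    and m: "m \<in> carrier_vec n" and e: "e \<in> carrier_vec n" and z: "z \<in> carrier_vec n"
  shows "quadratic_fun M g c (m + (t \<cdot>\<^sub>v e + s \<cdot>\<^sub>v z))
    = (e \<bullet> (M *\<^sub>v e)) * t\<^sup>2 + 2 * (e \<bullet> (M *\<^sub>v z)) * t * s + (z \<bullet> (M *\<^sub>v z)) * s\<^sup>2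
      + 2 * (e \<bullet> (M *\<^sub>v m + g)) * t + 2 * (z \<bullet> (M *\<^sub>v m + g)) * s + quadratic_fun M g c m"
proof -
  have Mm: "M *\<^sub>v m + g \<in> carrier_vec n" "s \<cdot>\<^sub>v z \<in> carrier_vec n" "t \<cdot>\<^sub>v e + s \<cdot>\<^sub>v z \<in> carrier_vec n"
    using M m g e z by auto
  show ?thesis
    unfolding quadratic_fun_expand[OF M g m Mm(3)] symmetric_form_add_smult[OF M e Mm(2)]
    using e z Mm M(1) by (simp add: add_scalar_prod_distrib[of _ n] mult_mat_vec[of _ n n] power2_eq_square algebra_simps)
qed

text \<open>The constant \<open>c\<close> is free so that the combination can be recentred at a
  point of the plane.\<close>

lemma quadratic_fun_lincomb:
  assumes A: "A \<in> carrier_mat n n" and B: "B \<in> carrier_mat n n"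
    and ab: "a \<in> carrier_vec n" "b \<in> carrier_vec n" and x: "x \<in> carrier_vec n"
  shows "quadratic_fun (r \<cdot>\<^sub>m A + s \<cdot>\<^sub>m B) (r \<cdot>\<^sub>v a + s \<cdot>\<^sub>v b) c x
    = r * quadratic_fun A a a0 x + s * quadratic_fun B b b0 x + (c - r * a0 - s * b0)"
proof -
  have "(r \<cdot>\<^sub>m A + s \<cdot>\<^sub>m B) *\<^sub>v x = r \<cdot>\<^sub>v (A *\<^sub>v x) + s \<cdot>\<^sub>v (B *\<^sub>v x)"
    using A B x by (intro eq_vecI) (auto simp: add_scalar_prod_distrib[of _ n])
  moreover have "A *\<^sub>v x \<in> carrier_vec n" "B *\<^sub>v x \<in> carrier_vec n" using A B x by auto
  ultimately show ?thesis
    using ab x unfolding quadratic_fun_def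
    by (simp add: scalar_prod_add_distrib[of _ n] add_scalar_prod_distrib[of _ n] algebra_simps)
qed

text \<open>Every \<open>z\<close> conjugate to \<open>e\<close> with respect to \<open>H\<close>
  spans with \<open>e\<close> a plane through \<open>m\<close> to which the planar lemma applies.
  Since each vector is a multiple of \<open>e\<close> plus such a \<open>z\<close>, the planar
  conclusions combine into statements about the whole space; \<open>2 u\<close> is the slope of the
  affine function \<open>k - \<kappa> h\<close>.\<close>

lemma separated_quadric_normalized:
  fixes H K :: "real mat" and h1 k1 :: "real vec" and h0 k0 :: real
  defines "h \<equiv> quadratic_fun H h1 h0" and "k \<equiv> quadratic_fun K k1 k0"
  assumes H: "H \<in> carrier_mat n n" "H\<^sup>T = H" and K: "K \<in> carrier_mat n n" "K\<^sup>T = K"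
    and hk: "h1 \<in> carrier_vec n" "k1 \<in> carrier_vec n"
    and me: "m \<in> carrier_vec n" "e \<in> carrier_vec n"
    and zero: "h (m + (- 1) \<cdot>\<^sub>v e) = 0" "h (m + 1 \<cdot>\<^sub>v e) = 0"
    and sides: "k (m + (- 1) \<cdot>\<^sub>v e) < 0" "0 < k (m + 1 \<cdot>\<^sub>v e)"
    and disj: "\<forall>v \<in> carrier_vec n. h v = 0 \<longrightarrow> k v \<noteq> 0"
    and eHe: "e \<bullet> (H *\<^sub>v e) = - 1"
  defines "\<kappa> \<equiv> - (e \<bullet> (K *\<^sub>v e))"
  defines "u \<equiv> k1 + (- \<kappa>) \<cdot>\<^sub>v h1"
  shows "K = \<kappa> \<cdot>\<^sub>m H" "u \<noteq> 0\<^sub>v n"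
    "\<And>v. v \<in> carrier_vec n \<Longrightarrow> H *\<^sub>v v = 0\<^sub>v n \<Longrightarrow> h1 \<bullet> v = 0 \<and> u \<bullet> v = 0"
    "\<And>x. x \<in> carrier_vec n \<Longrightarrow> u \<bullet> x = 0 \<Longrightarrow> 0 \<le> x \<bullet> (H *\<^sub>v x)"
proof -
  define gH where "gH = H *\<^sub>v m + h1"
  define gK where "gK = K *\<^sub>v m + k1"
  have g: "gH \<in> carrier_vec n" "gK \<in> carrier_vec n" using H K me hk by (auto simp: gH_def gK_def)
  have h_plane: "h (m + (t \<cdot>\<^sub>v e + s \<cdot>\<^sub>v z)) = - t\<^sup>2 + 2 * (e \<bullet> (H *\<^sub>v z)) * t * s + (z \<bullet> (H *\<^sub>v z)) * s\<^sup>2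
      + 2 * (e \<bullet> gH) * t + 2 * (z \<bullet> gH) * s + h m" if "z \<in> carrier_vec n" for z s t
    unfolding h_def gH_def using quadratic_fun_expand_plane[OF H hk(1) me that] eHe by simp
  have k_plane: "k (m + (t \<cdot>\<^sub>v e + s \<cdot>\<^sub>v z)) = - \<kappa> * t\<^sup>2 + 2 * (e \<bullet> (K *\<^sub>v z)) * t * s + (z \<bullet> (K *\<^sub>v z)) * s\<^sup>2
      + 2 * (e \<bullet> gK) * t + 2 * (z \<bullet> gK) * s + k m" if "z \<in> carrier_vec n" for z s t
    unfolding k_def gK_def \<kappa>_def using quadratic_fun_expand_plane[OF K hk(2) me that] by simp
  have line: "m + (t \<cdot>\<^sub>v e + 0 \<cdot>\<^sub>v z) = m + t \<cdot>\<^sub>v e" if "z \<in> carrier_vec n" for t z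
    using me that by (intro eq_vecI) auto
  \<comment> \<open>Along the line, \<open>h\<close> is a quadratic with leading coefficient
    \<open>- 1\<close> and zeros at \<open>- 1\<close> and \<open>1\<close>, hence
    \<open>1 - t\<^sup>2\<close>.\<close>
  have "h m = 1" and ge: "e \<bullet> gH = 0"
    using h_plane[OF me(2), of "- 1" 0] h_plane[OF me(2), of 1 0]
    unfolding line[OF me(2)] zero by simp_all
  have hyp: "e \<bullet> (K *\<^sub>v z) = 0" "z \<bullet> (K *\<^sub>v z) = \<kappa> * (z \<bullet> (H *\<^sub>v z))" "0 < e \<bullet> gK"
      "(z \<bullet> gK - \<kappa> * (z \<bullet> gH))\<^sup>2 \<le> (e \<bullet> gK)\<^sup>2 * (z \<bullet> (H *\<^sub>v z))"
      "z \<bullet> (H *\<^sub>v z) = 0 \<Longrightarrow> z \<bullet> gH = 0"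
    if z: "z \<in> carrier_vec n" and ez: "e \<bullet> (H *\<^sub>v z) = 0" for z
  proof -
    have h': "h (m + (t \<cdot>\<^sub>v e + s \<cdot>\<^sub>v z)) = 1 - t\<^sup>2 + (z \<bullet> (H *\<^sub>v z)) * s\<^sup>2 + 2 * (z \<bullet> gH) * s" for t s
      using h_plane[OF z] ez ge \<open>h m = 1\<close> by simp
    have carr: "m + (t \<cdot>\<^sub>v e + s \<cdot>\<^sub>v z) \<in> carrier_vec n" for t s using me z by simp
    \<comment> \<open>The coefficient of \<open>t\<^sup>2\<close> in \<open>k\<close> is
      \<open>- \<kappa>\<close>, which takes the place of the planar
      \<open>\<kappa>\<close>.\<close>
    note hyperbola = separated_hyperbola[of "- \<kappa>" "e \<bullet> (K *\<^sub>v z)" "z \<bullet> (K *\<^sub>v z)" "e \<bullet> gK" "z \<bullet> gK" "k m"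
        "z \<bullet> (H *\<^sub>v z)" "z \<bullet> gH", folded k_plane[OF z] h', OF _ _ disj[rule_format, OF carr]]
    have sides': "k (m + ((- 1) \<cdot>\<^sub>v e + 0 \<cdot>\<^sub>v z)) < 0" "0 < k (m + (1 \<cdot>\<^sub>v e + 0 \<cdot>\<^sub>v z))"
      unfolding line[OF z] by (fact sides)+
    show "e \<bullet> (K *\<^sub>v z) = 0" "z \<bullet> (K *\<^sub>v z) = \<kappa> * (z \<bullet> (H *\<^sub>v z))" "0 < e \<bullet> gK"
      "(z \<bullet> gK - \<kappa> * (z \<bullet> gH))\<^sup>2 \<le> (e \<bullet> gK)\<^sup>2 * (z \<bullet> (H *\<^sub>v z))"
      "z \<bullet> (H *\<^sub>v z) = 0 \<Longrightarrow> z \<bullet> gH = 0"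
      using hyperbola[OF sides'] by simp_all
  qed
  \<comment> \<open>Because the form is \<open>- 1\<close> at \<open>e\<close>, adding
    \<open>e \<bullet> (H *\<^sub>v x)\<close> times \<open>e\<close> to \<open>x\<close> makes it
    conjugate to \<open>e\<close>.\<close>
  have split: "\<exists>t z. z \<in> carrier_vec n \<and> e \<bullet> (H *\<^sub>v z) = 0 \<and> x = t \<cdot>\<^sub>v e + z" if x: "x \<in> carrier_vec n" for x
  proof (intro exI conjI)
    let ?c = "e \<bullet> (H *\<^sub>v x)"
    have "H *\<^sub>v x \<in> carrier_vec n" "H *\<^sub>v e \<in> carrier_vec n" using H me x by auto
    then show "e \<bullet> (H *\<^sub>v (x + ?c \<cdot>\<^sub>v e)) = 0"
      using H(1) me x eHe
      by (simp add: mult_mat_vec[of _ n n] mult_add_distrib_mat_vec[of _ n n] scalar_prod_add_distrib[of _ n])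
    show "x = (- ?c) \<cdot>\<^sub>v e + (x + ?c \<cdot>\<^sub>v e)" using me x by (intro eq_vecI) auto
  qed (use me x in simp)
  have scaled: "\<kappa> \<cdot>\<^sub>m H \<in> carrier_mat n n" "(\<kappa> \<cdot>\<^sub>m H)\<^sup>T = \<kappa> \<cdot>\<^sub>m H"
      "\<And>x. x \<in> carrier_vec n \<Longrightarrow> (\<kappa> \<cdot>\<^sub>m H) *\<^sub>v x = \<kappa> \<cdot>\<^sub>v (H *\<^sub>v x)"
  proof -
    have "(\<kappa> \<cdot>\<^sub>m H)\<^sup>T = \<kappa> \<cdot>\<^sub>m H\<^sup>T" by (intro eq_matI) auto
    then show "(\<kappa> \<cdot>\<^sub>m H)\<^sup>T = \<kappa> \<cdot>\<^sub>m H" using H by simp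
    show "(\<kappa> \<cdot>\<^sub>m H) *\<^sub>v x = \<kappa> \<cdot>\<^sub>v (H *\<^sub>v x)" if "x \<in> carrier_vec n" for x
      using H that by (intro eq_vecI) auto
  qed (use H in simp)
  show KH: "K = \<kappa> \<cdot>\<^sub>m H"
  proof (rule symmetric_eq_of_form_eq[OF K scaled(1,2)])
    fix x :: "real vec" assume x: "x \<in> carrier_vec n"
    obtain t z where z: "z \<in> carrier_vec n" "e \<bullet> (H *\<^sub>v z) = 0" "x = t \<cdot>\<^sub>v e + z"
      using split[OF x] by blast
    have "x \<bullet> (K *\<^sub>v x) = \<kappa> * (x \<bullet> (H *\<^sub>v x))"
      unfolding z(3) symmetric_form_add_smult[OF K me(2) z(1)] symmetric_form_add_smult[OF H me(2) z(1)]
      using hyp(1,2)[OF z(1,2)] z(2) eHe by (simp add: \<kappa>_def algebra_simps)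
    then show "x \<bullet> (K *\<^sub>v x) = x \<bullet> ((\<kappa> \<cdot>\<^sub>m H) *\<^sub>v x)"
      using scaled(3)[OF x] x H by simp
  qed
  have u: "u \<in> carrier_vec n" using hk by (simp add: u_def)
  \<comment> \<open>As \<open>K\<close> is \<open>\<kappa>\<close> times \<open>H\<close>, the
    contributions of \<open>m\<close> cancel, and \<open>u\<close> can be computed from the slopes
    at the centre.\<close>
  have "u = gK + (- \<kappa>) \<cdot>\<^sub>v gH"
    using hk me H scaled(3)[OF me(1)] by (intro eq_vecI) (auto simp: u_def gK_def gH_def KH algebra_simps)
  then have u_dot: "w \<bullet> u = w \<bullet> gK - \<kappa> * (w \<bullet> gH)" if "w \<in> carrier_vec n" for w
    using that g by (simp add: scalar_prod_add_distrib[of _ n])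
  have eu: "e \<bullet> u = e \<bullet> gK" using u_dot[OF me(2)] ge by simp
  \<comment> \<open>The degenerate plane with \<open>z = 0\<close> already gives the sign of the
    slope along \<open>e\<close>.\<close>
  have j: "0 < e \<bullet> gK"
  proof -
    have "H *\<^sub>v 0\<^sub>v n = 0\<^sub>v n" using H by (intro eq_vecI) auto
    then show ?thesis using hyp(3)[of "0\<^sub>v n"] me by simp
  qed
  then show "u \<noteq> 0\<^sub>v n" using eu me by auto
  \<comment> \<open>A kernel vector is conjugate to \<open>e\<close> and has form value zero: the
    last planar conclusion kills the slope of \<open>h\<close> along it, and the slope bound kills
    that of \<open>k - \<kappa> h\<close>.\<close>
  show "h1 \<bullet> v = 0 \<and> u \<bullet> v = 0" if v: "v \<in> carrier_vec n" "H *\<^sub>v v = 0\<^sub>v n" for v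
  proof -
    have ez: "e \<bullet> (H *\<^sub>v v) = 0" "v \<bullet> (H *\<^sub>v v) = 0" using v me by auto
    have "v \<bullet> gH = 0" using hyp(5)[OF v(1) ez(1)] ez(2) by simp
    moreover have "v \<bullet> gH = v \<bullet> h1"
      using v H me hk symmetric_form_commute[OF H v(1) me(1)]
      by (simp add: gH_def scalar_prod_add_distrib[of _ n])
    moreover have "v \<bullet> u = 0"
      using hyp(4)[OF v(1) ez(1)] ez(2) u_dot[OF v(1)] by simp
    ultimately show ?thesis using v u hk by (simp add: comm_scalar_prod[of _ n v])
  qed
  \<comment> \<open>At \<open>x = t e + z\<close> the form is
    \<open>z \<bullet> (H *\<^sub>v z) - t\<^sup>2\<close>. Orthogonality to \<open>u\<close> makes
    the slope along \<open>z\<close> equal to \<open>- t\<close> times the slope along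
    \<open>e\<close>, so the slope bound is exactly nonnegativity.\<close>
  show "0 \<le> x \<bullet> (H *\<^sub>v x)" if x: "x \<in> carrier_vec n" "u \<bullet> x = 0" for x
  proof -
    obtain t z where z: "z \<in> carrier_vec n" "e \<bullet> (H *\<^sub>v z) = 0" "x = t \<cdot>\<^sub>v e + z"
      using split[OF x(1)] by blast
    have "x \<bullet> u = 0" using x u by (simp add: comm_scalar_prod[of x n u])
    then have "z \<bullet> u = - (t * (e \<bullet> gK))"
      using z me u eu by (simp add: add_scalar_prod_distrib[of _ n])
    then have "(e \<bullet> gK)\<^sup>2 * t\<^sup>2 \<le> (e \<bullet> gK)\<^sup>2 * (z \<bullet> (H *\<^sub>v z))"
      using hyp(4)[OF z(1,2)] u_dot[OF z(1)] by (simp add: power_mult_distrib mult.commute)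
    then have "t\<^sup>2 \<le> z \<bullet> (H *\<^sub>v z)" using j by (simp add: mult_le_cancel_left)
    then show ?thesis
      unfolding z(3) symmetric_form_add_smult[OF H me(2) z(1)] using z(2) eHe by simp
  qed
qed

text \<open>Reduces to the normalized case with the midpoint \<open>m\<close> and half difference
  \<open>e\<close> of the two points. Scaling \<open>h\<close> by \<open>\<omega>\<close> preserves
  its zero set but may flip its sign, so \<open>\<omega>\<close> stays in the conclusions about
  signs of the form.\<close>

lemma separated_quadric:
  fixes H K :: "real mat" and h1 k1 :: "real vec" and h0 k0 :: real
  defines "h \<equiv> quadratic_fun H h1 h0" and "k \<equiv> quadratic_fun K k1 k0"
  assumes H: "H \<in> carrier_mat n n" "H\<^sup>T = H" and K: "K \<in> carrier_mat n n" "K\<^sup>T = K"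
    and hk: "h1 \<in> carrier_vec n" "k1 \<in> carrier_vec n"
    and xy: "x \<in> carrier_vec n" "y \<in> carrier_vec n"
    and zero: "h x = 0" "h y = 0" and sides: "k x < 0" "0 < k y"
    and disj: "\<forall>v \<in> carrier_vec n. h v = 0 \<longrightarrow> k v \<noteq> 0"
  obtains \<omega> \<kappa> where "K = \<kappa> \<cdot>\<^sub>m H" "k1 + (- \<kappa>) \<cdot>\<^sub>v h1 \<noteq> 0\<^sub>v n"
    "\<forall>v \<in> carrier_vec n. H *\<^sub>v v = 0\<^sub>v n \<longrightarrow> h1 \<bullet> v = 0 \<and> (k1 + (- \<kappa>) \<cdot>\<^sub>v h1) \<bullet> v = 0"
    "\<exists>e \<in> carrier_vec n. \<omega> * (e \<bullet> (H *\<^sub>v e)) < 0"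
    "\<forall>v \<in> carrier_vec n. (k1 + (- \<kappa>) \<cdot>\<^sub>v h1) \<bullet> v = 0 \<longrightarrow> 0 \<le> \<omega> * (v \<bullet> (H *\<^sub>v v))"
proof -
  define m where "m = (1 / 2) \<cdot>\<^sub>v (x + y)"
  define e where "e = (1 / 2) \<cdot>\<^sub>v (y - x)"
  have me: "m \<in> carrier_vec n" "e \<in> carrier_vec n" using xy by (auto simp: m_def e_def)
  have x: "m + (- 1) \<cdot>\<^sub>v e = x" and y: "m + 1 \<cdot>\<^sub>v e = y"
    using xy by (auto simp: m_def e_def field_simps intro!: eq_vecI)
  have line: "m + (t \<cdot>\<^sub>v e + 0 \<cdot>\<^sub>v e) = m + t \<cdot>\<^sub>v e" for t
    using me by (intro eq_vecI) auto
  note h_line = quadratic_fun_expand_plane[OF H hk(1) me me(2), of h0 _ 0, unfolded line, folded h_def]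
  note k_line = quadratic_fun_expand_plane[OF K hk(2) me me(2), of k0 _ 0, unfolded line, folded k_def]
  \<comment> \<open>Otherwise \<open>h\<close> is affine on the line through \<open>x\<close> and
    \<open>y\<close> and vanishes at both points, hence on the whole line, where \<open>k\<close>
    must have a zero between them.\<close>
  have \<eta>: "e \<bullet> (H *\<^sub>v e) \<noteq> 0"
  proof
    assume flat: "e \<bullet> (H *\<^sub>v e) = 0"
    have "h m = 0" "e \<bullet> (H *\<^sub>v m + h1) = 0"
      using h_line[of "- 1"] h_line[of 1] unfolding x y zero flat by simp_all
    then have h0: "h (m + t \<cdot>\<^sub>v e) = 0" for t using h_line[of t] flat by simp
    have "continuous_on {- 1..1} (\<lambda>t. k (m + t \<cdot>\<^sub>v e))"
      unfolding k_line by (intro continuous_intros)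
    moreover have "k (m + (- 1) \<cdot>\<^sub>v e) \<le> 0" "0 \<le> k (m + 1 \<cdot>\<^sub>v e)"
      unfolding x y using sides by simp_all
    ultimately obtain t where "k (m + t \<cdot>\<^sub>v e) = 0"
      using IVT'[of "\<lambda>t. k (m + t \<cdot>\<^sub>v e)" "- 1" 0 1] by auto
    then show False using disj h0 me by simp
  qed
  define \<omega> where "\<omega> = - 1 / (e \<bullet> (H *\<^sub>v e))"
  have \<omega>: "\<omega> \<noteq> 0" using \<eta> by (simp add: \<omega>_def)
  have mult: "(\<omega> \<cdot>\<^sub>m H) *\<^sub>v v = \<omega> \<cdot>\<^sub>v (H *\<^sub>v v)" if "v \<in> carrier_vec n" for v
    using H that by (intro eq_vecI) auto
  have "(\<omega> \<cdot>\<^sub>m H)\<^sup>T = \<omega> \<cdot>\<^sub>m H\<^sup>T" by (intro eq_matI) auto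
  then have \<omega>H: "\<omega> \<cdot>\<^sub>m H \<in> carrier_mat n n" "(\<omega> \<cdot>\<^sub>m H)\<^sup>T = \<omega> \<cdot>\<^sub>m H" using H by simp_all
  have \<omega>h: "quadratic_fun (\<omega> \<cdot>\<^sub>m H) (\<omega> \<cdot>\<^sub>v h1) (\<omega> * h0) v = \<omega> * h v" if "v \<in> carrier_vec n" for v
    using mult[OF that] that H hk by (simp add: h_def quadratic_fun_def algebra_simps)
  let ?\<kappa> = "- (e \<bullet> (K *\<^sub>v e))"
  have norm: "e \<bullet> ((\<omega> \<cdot>\<^sub>m H) *\<^sub>v e) = - 1"
    using mult[OF me(2)] me H \<eta> by (simp add: \<omega>_def)
  have zero': "quadratic_fun (\<omega> \<cdot>\<^sub>m H) (\<omega> \<cdot>\<^sub>v h1) (\<omega> * h0) (m + (- 1) \<cdot>\<^sub>v e) = 0"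
      "quadratic_fun (\<omega> \<cdot>\<^sub>m H) (\<omega> \<cdot>\<^sub>v h1) (\<omega> * h0) (m + 1 \<cdot>\<^sub>v e) = 0"
    unfolding x y using \<omega>h xy zero by simp_all
  have sides': "quadratic_fun K k1 k0 (m + (- 1) \<cdot>\<^sub>v e) < 0" "0 < quadratic_fun K k1 k0 (m + 1 \<cdot>\<^sub>v e)"
    unfolding x y using sides by (simp_all add: k_def)
  have disj': "\<forall>v \<in> carrier_vec n.
      quadratic_fun (\<omega> \<cdot>\<^sub>m H) (\<omega> \<cdot>\<^sub>v h1) (\<omega> * h0) v = 0 \<longrightarrow> quadratic_fun K k1 k0 v \<noteq> 0"
    using disj \<omega>h \<omega> by (simp add: k_def)
  have "\<omega> \<cdot>\<^sub>v h1 \<in> carrier_vec n" using hk by simp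
  note core = separated_quadric_normalized[OF \<omega>H K this hk(2) me zero' sides' disj' norm]
  have u: "k1 + (- ?\<kappa>) \<cdot>\<^sub>v (\<omega> \<cdot>\<^sub>v h1) = k1 + (- (?\<kappa> * \<omega>)) \<cdot>\<^sub>v h1"
    by (simp add: smult_smult_assoc)
  show ?thesis
  proof (rule that[of "?\<kappa> * \<omega>" \<omega>])
    have "(?\<kappa> * \<omega>) \<cdot>\<^sub>m H = ?\<kappa> \<cdot>\<^sub>m (\<omega> \<cdot>\<^sub>m H)" by (intro eq_matI) auto
    then show "K = (?\<kappa> * \<omega>) \<cdot>\<^sub>m H" using core(1) by simp
    show "k1 + (- (?\<kappa> * \<omega>)) \<cdot>\<^sub>v h1 \<noteq> 0\<^sub>v n" using core(2) unfolding u .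
    have "h1 \<bullet> v = 0 \<and> (k1 + (- (?\<kappa> * \<omega>)) \<cdot>\<^sub>v h1) \<bullet> v = 0"
      if "v \<in> carrier_vec n" "H *\<^sub>v v = 0\<^sub>v n" for v
      using core(3)[OF that(1)] that mult[OF that(1)] \<omega> hk unfolding u by simp
    then show "\<forall>v \<in> carrier_vec n. H *\<^sub>v v = 0\<^sub>v n \<longrightarrow> h1 \<bullet> v = 0 \<and> (k1 + (- (?\<kappa> * \<omega>)) \<cdot>\<^sub>v h1) \<bullet> v = 0"
      by blast
    show "\<exists>e \<in> carrier_vec n. \<omega> * (e \<bullet> (H *\<^sub>v e)) < 0"
      using me(2) \<eta> by (intro bexI[of _ e]) (simp_all add: \<omega>_def)
    have "0 \<le> \<omega> * (v \<bullet> (H *\<^sub>v v))"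
      if "v \<in> carrier_vec n" "(k1 + (- (?\<kappa> * \<omega>)) \<cdot>\<^sub>v h1) \<bullet> v = 0" for v
      using core(4)[OF that(1)] that mult[OF that(1)] H unfolding u by simp
    then show "\<forall>v \<in> carrier_vec n. (k1 + (- (?\<kappa> * \<omega>)) \<cdot>\<^sub>v h1) \<bullet> v = 0 \<longrightarrow> 0 \<le> \<omega> * (v \<bullet> (H *\<^sub>v v))"
      by blast
  qed
qed

section \<open>Joint ranges\<close>

text \<open>Frees condition (B3) from the choice of basis: only the range of \<open>V\<close>
  matters.\<close>

lemma pos_semidef_congruence_iff:
  assumes M: "M \<in> carrier_mat n n" "M\<^sup>T = M" and V: "V \<in> carrier_mat n m"
  shows "pos_semidef (V\<^sup>T * M * V) \<longleftrightarrow> (\<forall>x \<in> range_space V. 0 \<le> x \<bullet> (M *\<^sub>v x))"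
proof -
  define W where "W = V\<^sup>T * M * V"
  have W: "W = V\<^sup>T * (M * V)" using M V by (simp add: W_def)
  then have carr: "W \<in> carrier_mat m m" using M V by auto
  have "W\<^sup>T = W"
    using M V transpose_mult[of "V\<^sup>T" m n "M * V" m] transpose_mult[of M n n V m] by (simp add: W)
  moreover have "y \<bullet> (W *\<^sub>v y) = (V *\<^sub>v y) \<bullet> (M *\<^sub>v (V *\<^sub>v y))" if y: "y \<in> carrier_vec m" for y
  proof -
    have Vy: "V *\<^sub>v y \<in> carrier_vec n" "M *\<^sub>v (V *\<^sub>v y) \<in> carrier_vec n" using M V y by auto
    have "W *\<^sub>v y = V\<^sup>T *\<^sub>v (M *\<^sub>v (V *\<^sub>v y))"
      using M V y assoc_mult_mat_vec[of "V\<^sup>T" m n "M * V" m y] by (simp add: W)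
    then show ?thesis
      using transpose_vec_mult_scalar[OF V y Vy(2)] y V Vy
        comm_scalar_prod[of y m "V\<^sup>T *\<^sub>v (M *\<^sub>v (V *\<^sub>v y))"] comm_scalar_prod[OF Vy] by simp
  qed
  moreover have range_eq: "range_space V = (\<lambda>y. V *\<^sub>v y) ` carrier_vec m"
    by (auto simp: mem_range_space_iff[OF V])
  moreover have "square_mat W" "dim_row W = m" using carr by auto
  ultimately have "pos_semidef W \<longleftrightarrow> (\<forall>x \<in> range_space V. 0 \<le> x \<bullet> (M *\<^sub>v x))"
    unfolding pos_semidef_def range_eq by simp
  then show ?thesis by (simp add: W_def)
qed

lemma mat_kernel_mat_of_row:
  fixes d :: "real vec"
  assumes "d \<in> carrier_vec n"
  shows "mat_kernel (mat_of_row d) = {x \<in> carrier_vec n. d \<bullet> x = 0}"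
proof -
  have "mat_of_row d *\<^sub>v x = 0\<^sub>v 1 \<longleftrightarrow> d \<bullet> x = 0" for x
    by (auto simp: vec_eq_iff)
  then show ?thesis using assms by (auto simp: mat_kernel_def)
qed

lemma not_convexE:
  fixes S :: "(real \<times> real) set"
  assumes "\<not> convex S"
  obtains p q t where "p \<in> S" "q \<in> S" "0 < t" "t < 1" "p + t *\<^sub>R (q - p) \<notin> S"
proof -
  obtain p q t where *: "p \<in> S" "q \<in> S" "0 \<le> t" "t \<le> 1" "(1 - t) *\<^sub>R p + t *\<^sub>R q \<notin> S"
    using assms by (auto simp: convex_alt)
  have eq: "(1 - t) *\<^sub>R p + t *\<^sub>R q = p + t *\<^sub>R (q - p)" by (simp add: algebra_simps)
  have "t \<noteq> 0" "t \<noteq> 1" using * by auto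
  then show ?thesis using that[of p q t] * eq by auto
qed

text \<open>A missing point of a segment makes the components normal to and along the segment a
  separated pair. The resulting relation between the two rotated combinations is then solved for
  \<open>B\<close> in terms of \<open>A\<close>.\<close>

lemma not_convex_joint_rangeE:
  fixes A B :: "real mat" and a b :: "real vec" and a0 b0 :: real
  assumes A: "A \<in> carrier_mat n n" "A\<^sup>T = A" "A \<noteq> 0\<^sub>m n n"
    and B: "B \<in> carrier_mat n n" "B\<^sup>T = B"
    and ab: "a \<in> carrier_vec n" "b \<in> carrier_vec n"
    and nonconvex: "\<not> convex (joint_range n (quadratic_fun A a a0) (quadratic_fun B b b0))"
  obtains lam \<sigma> where "B = lam \<cdot>\<^sub>m A" "(- lam) \<cdot>\<^sub>v a + b \<noteq> 0\<^sub>v n"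
    "\<And>v. v \<in> carrier_vec n \<Longrightarrow> A *\<^sub>v v = 0\<^sub>v n \<Longrightarrow> a \<bullet> v = 0 \<and> ((- lam) \<cdot>\<^sub>v a + b) \<bullet> v = 0"
    "\<exists>e \<in> carrier_vec n. \<sigma> * (e \<bullet> (A *\<^sub>v e)) < 0"
    "\<And>v. v \<in> carrier_vec n \<Longrightarrow> ((- lam) \<cdot>\<^sub>v a + b) \<bullet> v = 0 \<Longrightarrow> 0 \<le> \<sigma> * (v \<bullet> (A *\<^sub>v v))"
proof -
  let ?f = "quadratic_fun A a a0" and ?g = "quadratic_fun B b b0"
  obtain p q t where pq: "p \<in> joint_range n ?f ?g" "q \<in> joint_range n ?f ?g" and t: "0 < t" "t < 1"
    and w: "p + t *\<^sub>R (q - p) \<notin> joint_range n ?f ?g"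
    using not_convexE[OF nonconvex] by blast
  obtain x y where xy: "x \<in> carrier_vec n" "y \<in> carrier_vec n" and p: "p = (?f x, ?g x)" and q: "q = (?f y, ?g y)"
    using pq by (auto simp: joint_range_def)
  define d1 where "d1 = ?f y - ?f x"
  define d2 where "d2 = ?g y - ?g x"
  define D where "D = d1\<^sup>2 + d2\<^sup>2"
  define w1 where "w1 = ?f x + t * d1"
  define w2 where "w2 = ?g x + t * d2"
  have w': "?f v \<noteq> w1 \<or> ?g v \<noteq> w2" if "v \<in> carrier_vec n" for v
    using w that by (auto simp: joint_range_def p q w1_def w2_def d1_def d2_def)
  have "d1 \<noteq> 0 \<or> d2 \<noteq> 0" using w'[OF xy(1)] by (auto simp: w1_def w2_def)
  then have D: "0 < D" by (auto simp: D_def sum_power2_gt_zero_iff)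
  \<comment> \<open>The segment has direction \<open>(d1, d2)\<close> and the missing point is
    \<open>(w1, w2)\<close>: \<open>?H\<close> belongs to the normal component, \<open>?K\<close> to
    the one along the segment.\<close>
  let ?H = "(- d2) \<cdot>\<^sub>m A + d1 \<cdot>\<^sub>m B" and ?h1 = "(- d2) \<cdot>\<^sub>v a + d1 \<cdot>\<^sub>v b"
    and ?h0 = "- d2 * (a0 - w1) + d1 * (b0 - w2)"
  let ?K = "d1 \<cdot>\<^sub>m A + d2 \<cdot>\<^sub>m B" and ?k1 = "d1 \<cdot>\<^sub>v a + d2 \<cdot>\<^sub>v b"
    and ?k0 = "d1 * (a0 - w1) + d2 * (b0 - w2)"
  have h: "quadratic_fun ?H ?h1 ?h0 v = - d2 * (?f v - w1) + d1 * (?g v - w2)" if "v \<in> carrier_vec n" for v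
    unfolding quadratic_fun_lincomb[OF A(1) B(1) ab that, of _ _ _ a0 b0] by (simp add: algebra_simps)
  have k: "quadratic_fun ?K ?k1 ?k0 v = d1 * (?f v - w1) + d2 * (?g v - w2)" if "v \<in> carrier_vec n" for v
    unfolding quadratic_fun_lincomb[OF A(1) B(1) ab that, of _ _ _ a0 b0] by (simp add: algebra_simps)
  have sym: "(r \<cdot>\<^sub>m A + s \<cdot>\<^sub>m B)\<^sup>T = r \<cdot>\<^sub>m A + s \<cdot>\<^sub>m B" for r s
  proof -
    have "(r \<cdot>\<^sub>m A + s \<cdot>\<^sub>m B)\<^sup>T = r \<cdot>\<^sub>m A\<^sup>T + s \<cdot>\<^sub>m B\<^sup>T" using A(1) B(1) by (intro eq_matI) auto
    then show ?thesis using A B by simp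
  qed
  have HK: "?H \<in> carrier_mat n n" "?K \<in> carrier_mat n n" "?h1 \<in> carrier_vec n" "?k1 \<in> carrier_vec n"
    using A B ab by auto
  have fx: "?f x - w1 = - (t * d1)" "?g x - w2 = - (t * d2)" by (simp_all add: w1_def w2_def)
  have fy: "?f y - w1 = (1 - t) * d1" "?g y - w2 = (1 - t) * d2"
    by (simp_all add: w1_def w2_def d1_def d2_def algebra_simps)
  have zero: "quadratic_fun ?H ?h1 ?h0 x = 0" "quadratic_fun ?H ?h1 ?h0 y = 0"
    using h xy fx fy by simp_all
  have "quadratic_fun ?K ?k1 ?k0 x = - (t * D)" "quadratic_fun ?K ?k1 ?k0 y = (1 - t) * D"
    unfolding k[OF xy(1)] k[OF xy(2)] fx fy by (simp_all add: D_def power2_eq_square algebra_simps)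
  then have sides: "quadratic_fun ?K ?k1 ?k0 x < 0" "0 < quadratic_fun ?K ?k1 ?k0 y"
    using t D by simp_all
  have "quadratic_fun ?K ?k1 ?k0 v \<noteq> 0"
    if v: "v \<in> carrier_vec n" and h_zero: "quadratic_fun ?H ?h1 ?h0 v = 0" for v
  proof
    assume k_zero: "quadratic_fun ?K ?k1 ?k0 v = 0"
    let ?\<phi> = "?f v - w1" and ?\<psi> = "?g v - w2"
    have eqs: "- d2 * ?\<phi> + d1 * ?\<psi> = 0" "d1 * ?\<phi> + d2 * ?\<psi> = 0"
      using h[OF v] k[OF v] h_zero k_zero by simp_all
    have "D * ?\<phi> = d1 * (d1 * ?\<phi> + d2 * ?\<psi>) - d2 * (- d2 * ?\<phi> + d1 * ?\<psi>)"
      "D * ?\<psi> = d2 * (d1 * ?\<phi> + d2 * ?\<psi>) + d1 * (- d2 * ?\<phi> + d1 * ?\<psi>)"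
      by (simp_all add: D_def power2_eq_square algebra_simps)
    then have "?\<phi> = 0" "?\<psi> = 0" unfolding eqs using D by simp_all
    then show False using w'[OF v] by simp
  qed
  then have "\<forall>v \<in> carrier_vec n. quadratic_fun ?H ?h1 ?h0 v = 0 \<longrightarrow> quadratic_fun ?K ?k1 ?k0 v \<noteq> 0"
    by blast
  note separated = separated_quadric[OF HK(1) sym HK(2) sym HK(3,4) xy zero sides this]
  obtain \<omega> \<kappa> where K: "?K = \<kappa> \<cdot>\<^sub>m ?H" and u: "?k1 + (- \<kappa>) \<cdot>\<^sub>v ?h1 \<noteq> 0\<^sub>v n"
    and ker: "\<forall>v \<in> carrier_vec n. ?H *\<^sub>v v = 0\<^sub>v n \<longrightarrow> ?h1 \<bullet> v = 0 \<and> (?k1 + (- \<kappa>) \<cdot>\<^sub>v ?h1) \<bullet> v = 0"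
    and neg: "\<exists>e \<in> carrier_vec n. \<omega> * (e \<bullet> (?H *\<^sub>v e)) < 0"
    and psd: "\<forall>v \<in> carrier_vec n. (?k1 + (- \<kappa>) \<cdot>\<^sub>v ?h1) \<bullet> v = 0 \<longrightarrow> 0 \<le> \<omega> * (v \<bullet> (?H *\<^sub>v v))"
    by (rule separated)
  \<comment> \<open>Collecting terms in \<open>?K = \<kappa> \<cdot>\<^sub>m ?H\<close> gives
    \<open>d1 + \<kappa> * d2\<close> times \<open>A\<close> equal to \<open>\<delta>\<close> times
    \<open>B\<close>. If \<open>\<delta>\<close> were zero, the other factor would be
    \<open>d1 * (1 + \<kappa>\<^sup>2)\<close>, which is nonzero, forcing
    \<open>A = 0\<close>.\<close>
  define \<delta> where "\<delta> = \<kappa> * d1 - d2"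
  have entries: "(d1 + \<kappa> * d2) * A $$ (i, j) = \<delta> * B $$ (i, j)" if "i < n" "j < n" for i j
    using arg_cong[OF K, of "\<lambda>X. X $$ (i, j)"] A B that by (simp add: \<delta>_def algebra_simps)
  have \<delta>: "\<delta> \<noteq> 0"
  proof
    assume "\<delta> = 0"
    then have d2: "d2 = \<kappa> * d1" by (simp add: \<delta>_def)
    have "d1 + \<kappa> * d2 = d1 * (1 + \<kappa>\<^sup>2)" by (simp add: d2 power2_eq_square algebra_simps)
    moreover have "1 + \<kappa>\<^sup>2 \<noteq> 0" using zero_le_power2[of \<kappa>] by linarith
    moreover have "d1 \<noteq> 0" using \<open>d1 \<noteq> 0 \<or> d2 \<noteq> 0\<close> d2 by auto
    ultimately have "A $$ (i, j) = 0" if "i < n" "j < n" for i j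
      using entries[OF that] \<open>\<delta> = 0\<close> by simp
    then have "A = 0\<^sub>m n n" using A(1) by (intro eq_matI) auto
    then show False using A(3) by simp
  qed
  define lam where "lam = (d1 + \<kappa> * d2) / \<delta>"
  \<comment> \<open>The factor with \<open>?H = \<tau> \<cdot>\<^sub>m A\<close>; it is nonzero
    because \<open>\<tau> * \<delta>\<close> is the squared length \<open>D\<close> of the
    segment.\<close>
  define \<tau> where "\<tau> = - d2 + d1 * lam"
  have BA: "B = lam \<cdot>\<^sub>m A"
    using entries A B \<delta> by (intro eq_matI) (auto simp: lam_def field_simps)
  have "\<tau> * \<delta> = D"
    using \<delta> by (simp add: \<tau>_def lam_def field_simps) (simp add: \<delta>_def D_def power2_eq_square algebra_simps)
  then have \<tau>: "\<tau> \<noteq> 0" using D by auto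
  have H_mult: "?H *\<^sub>v v = \<tau> \<cdot>\<^sub>v (A *\<^sub>v v)" if "v \<in> carrier_vec n" for v
  proof -
    have "?H = \<tau> \<cdot>\<^sub>m A" unfolding BA using A(1) by (intro eq_matI) (auto simp: \<tau>_def algebra_simps)
    then show ?thesis using A(1) that by (auto intro!: eq_vecI)
  qed
  let ?d = "(- lam) \<cdot>\<^sub>v a + b"
  have d: "?d \<in> carrier_vec n" using ab by simp
  have u_eq: "?k1 + (- \<kappa>) \<cdot>\<^sub>v ?h1 = (- \<delta>) \<cdot>\<^sub>v ?d"
  proof (rule eq_vecI)
    fix i assume "i < dim_vec ((- \<delta>) \<cdot>\<^sub>v ?d)"
    then have i: "i < n" using ab by simp
    have "d1 + \<kappa> * d2 = \<delta> * lam" using \<delta> by (simp add: lam_def)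
    then have "(d1 + \<kappa> * d2) * a $ i - \<delta> * b $ i = - \<delta> * (- lam * a $ i + b $ i)"
      by (simp add: algebra_simps)
    then show "(?k1 + (- \<kappa>) \<cdot>\<^sub>v ?h1) $ i = ((- \<delta>) \<cdot>\<^sub>v ?d) $ i"
      using i ab by (simp add: \<delta>_def algebra_simps)
  qed (use ab in simp)
  have h1_eq: "?h1 = \<tau> \<cdot>\<^sub>v a + d1 \<cdot>\<^sub>v ?d"
    using ab by (intro eq_vecI) (auto simp: \<tau>_def algebra_simps)
  show ?thesis
  proof (rule that[of lam "\<omega> * \<tau>"])
    show "B = lam \<cdot>\<^sub>m A" by (fact BA)
    show "?d \<noteq> 0\<^sub>v n" using u unfolding u_eq by auto
    show "a \<bullet> v = 0 \<and> ?d \<bullet> v = 0" if v: "v \<in> carrier_vec n" "A *\<^sub>v v = 0\<^sub>v n" for v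
    proof -
      have "?H *\<^sub>v v = 0\<^sub>v n" using H_mult[OF v(1)] v(2) by simp
      from ker[rule_format, OF v(1) this] have *: "?h1 \<bullet> v = 0" "(- \<delta>) * (?d \<bullet> v) = 0"
        unfolding u_eq using d v by simp_all
      then have dv: "?d \<bullet> v = 0" using \<delta> by simp
      have "?h1 \<bullet> v = \<tau> * (a \<bullet> v) + d1 * (?d \<bullet> v)"
        unfolding h1_eq smult_scalar_prod_distrib[OF ab(1) v(1), symmetric]
          smult_scalar_prod_distrib[OF d v(1), symmetric]
        by (rule add_scalar_prod_distrib) (use ab d v in simp_all)
      then show ?thesis using * dv \<tau> by simp
    qed
    show "\<exists>e \<in> carrier_vec n. \<omega> * \<tau> * (e \<bullet> (A *\<^sub>v e)) < 0"
      using neg H_mult A(1) by (auto simp: mult.assoc)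
    show "0 \<le> \<omega> * \<tau> * (v \<bullet> (A *\<^sub>v v))" if v: "v \<in> carrier_vec n" "?d \<bullet> v = 0" for v
      using psd[rule_format, OF v(1)] u_eq v d H_mult[OF v(1)] A(1) by (simp add: mult.assoc)
  qed
qed

text \<open>At a centre \<open>c\<close> with \<open>A c = - a\<close> the linear part of
  \<open>f\<close> disappears, and \<open>g\<close> is \<open>lam * f\<close> plus an affine
  function of slope \<open>2 d\<close>. The images of \<open>c + e\<close> and \<open>c - e\<close>
  agree in \<open>f\<close>, and their midpoint has the affine part at \<open>c\<close>. A preimage
  \<open>c + z\<close> of it would satisfy \<open>d \<bullet> z = 0\<close> with the same form value
  as \<open>e\<close>, of the forbidden sign.\<close>

lemma not_convex_joint_rangeI:
  fixes A :: "real mat" and a b :: "real vec" and a0 b0 lam :: real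
  defines "d \<equiv> (- lam) \<cdot>\<^sub>v a + b"
  assumes A: "A \<in> carrier_mat n n" "A\<^sup>T = A" and B: "B = lam \<cdot>\<^sub>m A"
    and ab: "a \<in> carrier_vec n" "b \<in> carrier_vec n"
    and range: "a \<in> range_space A"
    and neg: "e \<in> carrier_vec n" "\<sigma> * (e \<bullet> (A *\<^sub>v e)) < 0"
    and psd: "\<And>x. x \<in> carrier_vec n \<Longrightarrow> d \<bullet> x = 0 \<Longrightarrow> 0 \<le> \<sigma> * (x \<bullet> (A *\<^sub>v x))"
  shows "\<not> convex (joint_range n (quadratic_fun A a a0) (quadratic_fun B b b0))"
proof
  let ?f = "quadratic_fun A a a0" and ?g = "quadratic_fun B b b0"
  assume convex: "convex (joint_range n ?f ?g)"
  obtain c' where c': "c' \<in> carrier_vec n" "A *\<^sub>v c' = a" using range mem_range_space_iff[OF A(1)] by blast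
  define c where "c = (- 1) \<cdot>\<^sub>v c'"
  have c: "c \<in> carrier_vec n" using c' by (simp add: c_def)
  have "A *\<^sub>v c + a = 0\<^sub>v n"
    using c' A ab by (simp add: c_def mult_mat_vec[of _ n n]) (auto intro!: eq_vecI)
  then have f: "?f (c + z) = ?f c + z \<bullet> (A *\<^sub>v z)" if "z \<in> carrier_vec n" for z
    using quadratic_fun_expand[OF A ab(1) c that] that by simp
  have dc: "d \<in> carrier_vec n" using ab by (simp add: d_def)
  have g: "?g x = lam * ?f x + 2 * (d \<bullet> x) + (b0 - lam * a0)" if "x \<in> carrier_vec n" for x
  proof -
    have "B *\<^sub>v x = lam \<cdot>\<^sub>v (A *\<^sub>v x)" using A(1) that by (auto simp: B intro!: eq_vecI)
    moreover have "A *\<^sub>v x \<in> carrier_vec n" using A that by simp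
    ultimately show ?thesis
      using ab that by (simp add: quadratic_fun_def d_def add_scalar_prod_distrib[of _ n] algebra_simps)
  qed
  let ?e = "(- 1) \<cdot>\<^sub>v e"
  define r where "r = ?f c + e \<bullet> (A *\<^sub>v e)"
  have fe: "?f (c + e) = r" "?f (c + ?e) = r"
    using f[of e] f[of ?e] neg(1) A(1) by (simp_all add: r_def mult_mat_vec[of _ n n])
  have de: "d \<bullet> (c + e) = d \<bullet> c + d \<bullet> e" "d \<bullet> (c + ?e) = d \<bullet> c - d \<bullet> e"
    using dc c neg(1) by (simp_all add: scalar_prod_add_distrib[of _ n])
  have carr: "c + e \<in> carrier_vec n" "c + ?e \<in> carrier_vec n" using c neg by auto
  have "(1 / 2) *\<^sub>R (?f (c + e), ?g (c + e)) + (1 / 2) *\<^sub>R (?f (c + ?e), ?g (c + ?e)) \<in> joint_range n ?f ?g"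
    using carr by (intro convexD[OF convex]) (auto simp: joint_range_def)
  then obtain y where y: "y \<in> carrier_vec n" "?f y = r" "?g y = lam * r + 2 * (d \<bullet> c) + (b0 - lam * a0)"
    using g[OF carr(1)] g[OF carr(2)] fe de by (auto simp: joint_range_def field_simps)
  define z where "z = y + (- 1) \<cdot>\<^sub>v c"
  have z: "z \<in> carrier_vec n" using y c by (simp add: z_def)
  have "y = c + z" using y c by (intro eq_vecI) (auto simp: z_def)
  then have "z \<bullet> (A *\<^sub>v z) = e \<bullet> (A *\<^sub>v e)" using f[OF z] y(2) by (simp add: r_def)
  moreover have "d \<bullet> y = d \<bullet> c" using g[OF y(1)] y by simp
  then have "d \<bullet> z = 0" using dc y c by (simp add: z_def scalar_prod_add_distrib[of _ n])
  ultimately show False using psd[OF z] neg(2) by simp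
qed

text \<open>A single \<open>V\<close> suffices for all \<open>lam\<close>, since
  \<open>A \<noteq> 0\<close> leaves at most one \<open>lam\<close> with
  \<open>B = lam \<cdot>\<^sub>m A\<close>. If there is none, or if the vector in (B2) is zero, the
  right side is false and \<open>V\<close> is restricted only in its dimensions.\<close>

theorem theorem4p2:
  fixes n :: nat and A B V :: "real mat" and a b :: "real vec" and a0 b0 :: real
  assumes A: "A \<in> carrier_mat n n" "A\<^sup>T = A" "A \<noteq> 0\<^sub>m n n"
    and B: "B \<in> carrier_mat n n" "B\<^sup>T = B"
    and ab: "a \<in> carrier_vec n" "b \<in> carrier_vec n"
    and V: "V \<in> carrier_mat n (n - 1)"
      "\<And>lam. B = lam \<cdot>\<^sub>m A \<Longrightarrow> (- lam) \<cdot>\<^sub>v a + b \<noteq> 0\<^sub>v n \<Longrightarrow>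
         matrix_basis V (mat_kernel (mat_of_row ((- lam) \<cdot>\<^sub>v a + b)))"
  shows "\<not> convex (joint_range n (quadratic_fun A a a0) (quadratic_fun B b b0)) \<longleftrightarrow>
    (\<exists>Abar \<in> {A, - A}. \<exists>lam.
       B = lam \<cdot>\<^sub>m A \<and>
       neg_eigenvalue_count Abar = 1 \<and> a \<in> range_space A \<and>
       (- lam) \<cdot>\<^sub>v a + b \<in> range_space A \<and> (- lam) \<cdot>\<^sub>v a + b \<noteq> 0\<^sub>v n \<and>
       pos_semidef (V\<^sup>T * Abar * V))"
    (is "?nonconvex \<longleftrightarrow> ?conditions")
proof -
  have d_carr: "(- lam) \<cdot>\<^sub>v a + b \<in> carrier_vec n" for lam using ab by simp
  have minus_A: "- A \<in> carrier_mat n n" "(- A)\<^sup>T = - A"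
    using A by (auto simp: transpose_uminus)
  have Abar: "M \<in> carrier_mat n n" "M\<^sup>T = M" if "M \<in> {A, - A}" for M
    using that A minus_A by auto
  have sign: "\<exists>\<sigma>. \<forall>x \<in> carrier_vec n. x \<bullet> (M *\<^sub>v x) = \<sigma> * (x \<bullet> (A *\<^sub>v x))" if "M \<in> {A, - A}" for M
  proof (cases "M = A")
    case True then show ?thesis by (intro exI[of _ 1]) simp
  next
    case False
    then have "M = - A" using that by simp
    then show ?thesis using A(1) by (intro exI[of _ "- 1"]) simp
  qed
  have B3: "pos_semidef (V\<^sup>T * M * V) \<longleftrightarrow>
      (\<forall>x \<in> carrier_vec n. ((- lam) \<cdot>\<^sub>v a + b) \<bullet> x = 0 \<longrightarrow> 0 \<le> x \<bullet> (M *\<^sub>v x))"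
    if "M \<in> {A, - A}" "B = lam \<cdot>\<^sub>m A" "(- lam) \<cdot>\<^sub>v a + b \<noteq> 0\<^sub>v n" for M lam
  proof -
    have "range_space V = {x \<in> carrier_vec n. ((- lam) \<cdot>\<^sub>v a + b) \<bullet> x = 0}"
      using V(2)[OF that(2,3)] mat_kernel_mat_of_row[OF d_carr] by (simp add: matrix_basis_def)
    then show ?thesis
      unfolding pos_semidef_congruence_iff[OF Abar[OF that(1)] V(1)] by auto
  qed
  show ?thesis
  proof
    assume ?nonconvex
    then obtain lam \<sigma> where BA: "B = lam \<cdot>\<^sub>m A" and d0: "(- lam) \<cdot>\<^sub>v a + b \<noteq> 0\<^sub>v n"
      and ker: "\<And>v. v \<in> carrier_vec n \<Longrightarrow> A *\<^sub>v v = 0\<^sub>v n \<Longrightarrow> a \<bullet> v = 0 \<and> ((- lam) \<cdot>\<^sub>v a + b) \<bullet> v = 0"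
      and neg: "\<exists>e \<in> carrier_vec n. \<sigma> * (e \<bullet> (A *\<^sub>v e)) < 0"
      and psd: "\<And>v. v \<in> carrier_vec n \<Longrightarrow> ((- lam) \<cdot>\<^sub>v a + b) \<bullet> v = 0 \<Longrightarrow> 0 \<le> \<sigma> * (v \<bullet> (A *\<^sub>v v))"
      using not_convex_joint_rangeE[OF A B ab] by blast
    \<comment> \<open>The sign of \<open>\<sigma>\<close> chooses between \<open>A\<close> and
      \<open>- A\<close>; the value zero is excluded by \<open>neg\<close>.\<close>
    define M where "M = (if 0 < \<sigma> then A else - A)"
    have M: "M \<in> {A, - A}" by (simp add: M_def)
    have form: "x \<bullet> (M *\<^sub>v x) = sgn \<sigma> * (x \<bullet> (A *\<^sub>v x))" if "x \<in> carrier_vec n" for x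
      using neg that A(1) by (auto simp: M_def sgn_if)
    obtain e where e: "e \<in> carrier_vec n" "e \<bullet> (M *\<^sub>v e) < 0"
      using neg form by (auto simp: mult_less_0_iff sgn_if split: if_splits)
    have psd_M: "0 \<le> x \<bullet> (M *\<^sub>v x)" if "x \<in> carrier_vec n" "((- lam) \<cdot>\<^sub>v a + b) \<bullet> x = 0" for x
      using psd[OF that] form[OF that(1)] by (auto simp: zero_le_mult_iff sgn_if)
    obtain k where "k < 0" "eigenvalue M k"
      using symmetric_negative_eigenvalue[OF Abar[OF M] e] by blast
    then have "neg_eigenvalue_count M = 1"
      using neg_eigenvalue_count_pos[OF Abar(1)[OF M]] neg_eigenvalue_count_le_1[OF Abar[OF M] d_carr psd_M]
      by fastforce
    moreover have "a \<in> range_space A" "(- lam) \<cdot>\<^sub>v a + b \<in> range_space A"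
      using symmetric_range_of_kernel_orthogonal[OF A(1,2) ab(1)]
        symmetric_range_of_kernel_orthogonal[OF A(1,2) d_carr] ker by blast+
    moreover have "pos_semidef (V\<^sup>T * M * V)" using B3[OF M BA d0] psd_M by blast
    ultimately show ?conditions using M BA d0 by blast
  next
    assume ?conditions
    then obtain M lam where M: "M \<in> {A, - A}" and BA: "B = lam \<cdot>\<^sub>m A"
      and count: "neg_eigenvalue_count M = 1" and range: "a \<in> range_space A"
      and d0: "(- lam) \<cdot>\<^sub>v a + b \<noteq> 0\<^sub>v n" and psd: "pos_semidef (V\<^sup>T * M * V)"
      by blast
    obtain \<sigma> where \<sigma>: "\<And>x. x \<in> carrier_vec n \<Longrightarrow> x \<bullet> (M *\<^sub>v x) = \<sigma> * (x \<bullet> (A *\<^sub>v x))"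
      using sign[OF M] by blast
    obtain k where k: "k < 0" "eigenvalue M k"
      using neg_eigenvalue_count_posD[OF Abar(1)[OF M]] count by auto
    then obtain e where e: "e \<in> carrier_vec n" "e \<noteq> 0\<^sub>v n" "M *\<^sub>v e = k \<cdot>\<^sub>v e"
      using Abar(1)[OF M] by (auto simp: eigenvalue_def eigenvector_def)
    then have "e \<bullet> (M *\<^sub>v e) < 0"
      using k scalar_prod_self_pos[OF e(1,2)] by (simp add: mult_neg_pos)
    then show ?nonconvex
      using not_convex_joint_rangeI[OF A(1,2) BA ab range e(1), of \<sigma>] \<sigma> e(1) B3[OF M BA d0] psd by simp
  qed
qed

end
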